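(* Let $g\ge1$. In low degrees, the kernel of $|\bar\Delta_\omega|:|T(H)_\omega|\to|T(H)_\omega|^{\otimes2}$ is given by $$\mathrm{Ker}(|\bar\Delta_\omega|)^{(1)}=H,\qquad \mathrm{Ker}(|\bar\Delta_\omega|)^{(2)}=0,\qquad \mathrm{Ker}(|\bar\Delta_\omega|)^{(3)}=|HL(H)_\omega^{(2)}|\cong\wedge^3H/|H\omega|$$ for any $g\ge1$, and $\mathrm{Ker}(|\bar\Delta_\omega|)^{(4)}=|HL(H)_\omega^{(3)}|$ for $g\ne2$.
   Context: $\mathbb K$ is a field of characteristic $0$; $H$ is a $2g$-dimensional symplectic $\mathbb K$-vector space with symplectic basis $(x_i,y_i)_{1\le i\le g}$ and $\omega=\sum_i[x_i,y_i]\in H^{\otimes 2}$. $T(H)$ and $L(H)$ are the (non-completed) tensor algebra and free Lie algebra; $L(H)_\omega=L(H)/\langle\omega\rangle$ (Lie ideal) and $T(H)_\omega=T(H)/\langle\omega\rangle=UL(H)_\omega$, a graded Hopf algebra with coproduct $\Delta_\omega$ making $H$ primitive. $|A|=A/[A,A]$ (quotient vector space by the span of commutators). $\bar\Delta_\omega(x)=\Delta_\omega(x)-x\otimes1-1\otimes x$ and $|\bar\Delta_\omega|$ is the induced map on trace spaces. The superscript $(d)$ denotes the degree $d$ part. For subspaces $Z_1,Z_2$ of an algebra $A$, $|Z_1Z_2|$ is the image of $Z_1\otimes Z_2\to A\otimes A\xrightarrow{\mathrm{mult}}A\to|A|$. In $\wedge^3H/|H\omega|$, $\wedge^3H$ is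 identified with $|HL(H)^{(2)}|\subset|T(H)|$ (via $v_1\wedge v_2\wedge v_3\leftrightarrow|v_1[v_2,v_3]|$), and $|H\omega|$ denotes the image of $H\otimes\mathbb K\omega$ in it. *)

theory Defs
  imports Complex_Main "HOL-Library.Poly_Mapping" "HOL-Library.Product_Plus"
begin

section \<open>Linear algebra on finitely supported functions\<close>

definition pm_scale :: "'k::field \<Rightarrow> ('b \<Rightarrow>\<^sub>0 'k) \<Rightarrow> ('b \<Rightarrow>\<^sub>0 'k)" where
  "pm_scale c p = Poly_Mapping.map ((*) c) p"

lemma lookup_pm_scale [simp]: "Poly_Mapping.lookup (pm_scale c p) b = c * Poly_Mapping.lookup p b"
  unfolding pm_scale_def by (simp add: Poly_Mapping.map.rep_eq when_def)

global_interpretation pm: vector_space pm_scale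
  by standard (auto intro!: poly_mapping_eqI simp: lookup_add algebra_simps)

lemma pm_scale_single [simp]: "pm_scale c (Poly_Mapping.single b d) = Poly_Mapping.single b (c * d)"
  by (rule poly_mapping_eqI) (simp add: lookup_single when_def)

lemma pm_expand: "p = (\<Sum>b\<in>Poly_Mapping.keys p. pm_scale (Poly_Mapping.lookup p b) (Poly_Mapping.single b 1))"
proof (rule poly_mapping_eqI)
  fix b
  show "Poly_Mapping.lookup p b = Poly_Mapping.lookup (\<Sum>b\<in>Poly_Mapping.keys p. pm_scale (Poly_Mapping.lookup p b) (Poly_Mapping.single b 1)) b"
    by (simp add: lookup_sum lookup_single when_def in_keys_iff)
qed

definition lin_ext :: "('k \<Rightarrow> 'v \<Rightarrow> 'v) \<Rightarrow> ('b \<Rightarrow> 'v) \<Rightarrow> ('b \<Rightarrow>\<^sub>0 'k::field) \<Rightarrow> 'v::ab_group_add"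
  where "lin_ext s f p = (\<Sum>b\<in>Poly_Mapping.keys p. s (Poly_Mapping.lookup p b) (f b))"

lemma lin_ext_superset:
  assumes "vector_space s" "finite A" "Poly_Mapping.keys p \<subseteq> A"
  shows "lin_ext s f p = (\<Sum>b\<in>A. s (Poly_Mapping.lookup p b) (f b))"
proof -
  interpret vector_space s by fact
  show ?thesis unfolding lin_ext_def
    by (rule sum.mono_neutral_left) (use assms in \<open>auto simp: in_keys_iff\<close>)
qed

lemma lin_ext_single [simp]:
  assumes "vector_space s" shows "lin_ext s f (Poly_Mapping.single b c) = s c (f b)"
proof -
  interpret vector_space s by fact
  show ?thesis by (simp add: lin_ext_def)
qed

lemma linear_lin_ext:
  assumes "vector_space s" shows "Vector_Spaces.linear pm_scale s (lin_ext s f)"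
proof -
  interpret vector_space s by fact
  have add: "lin_ext s f (p + q) = lin_ext s f p + lin_ext s f q" for p q
  proof -
    let ?A = "Poly_Mapping.keys p \<union> Poly_Mapping.keys q"
    have "finite ?A" "Poly_Mapping.keys (p + q) \<subseteq> ?A" by (auto simp: in_keys_iff lookup_add)
    then show ?thesis
      by (simp add: lin_ext_superset[OF assms, of ?A] lookup_add scale_left_distrib sum.distrib)
  qed
  have scale: "lin_ext s f (pm_scale c p) = s c (lin_ext s f p)" for c p
  proof -
    have "finite (Poly_Mapping.keys p)" "Poly_Mapping.keys (pm_scale c p) \<subseteq> Poly_Mapping.keys p" by (auto simp: in_keys_iff)
    then show ?thesis
      by (simp add: lin_ext_superset[OF assms, of "Poly_Mapping.keys p"] scale_sum_right)
  qed
  interpret module_pair pm_scale s by unfold_locales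
  show ?thesis unfolding linear_iff_module_hom module_hom_iff
    using add scale by (auto intro: pm.module_axioms module_axioms)
qed

lemma linear_from_pm_eq:
  assumes f: "Vector_Spaces.linear pm_scale s f" and g: "Vector_Spaces.linear pm_scale s g"
    and eq: "\<And>b. f (Poly_Mapping.single b 1) = g (Poly_Mapping.single b 1)"
  shows "f p = g p"
proof -
  interpret f: Vector_Spaces.linear pm_scale s f by fact
  interpret g: Vector_Spaces.linear pm_scale s g by fact
  have "f p = (\<Sum>b\<in>Poly_Mapping.keys p. s (Poly_Mapping.lookup p b) (f (Poly_Mapping.single b 1)))"
    by (subst pm_expand[of p]) (simp only: f.sum f.scale)
  also have "\<dots> = (\<Sum>b\<in>Poly_Mapping.keys p. s (Poly_Mapping.lookup p b) (g (Poly_Mapping.single b 1)))"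
    by (simp add: eq)
  also have "\<dots> = g p"
    by (subst (3) pm_expand[of p]) (simp only: g.sum g.scale)
  finally show ?thesis .
qed

lemma linearI_pm:
  assumes "vector_space s" "\<And>x y. f (x + y) = f x + f y" "\<And>c x. f (pm_scale c x) = s c (f x)"
  shows "Vector_Spaces.linear pm_scale s f"
  unfolding linear_iff_module_hom module_hom_iff
  using assms by (auto intro: pm.vector_space_axioms simp: module_iff_vector_space)

lemma bilinear_from_pm_eq:
  assumes "\<And>q. Vector_Spaces.linear pm_scale s (\<lambda>p. f p q)" "\<And>p. Vector_Spaces.linear pm_scale s (f p)"
    and "\<And>q. Vector_Spaces.linear pm_scale s (\<lambda>p. g p q)" "\<And>p. Vector_Spaces.linear pm_scale s (g p)"
    and eq: "\<And>b c. f (Poly_Mapping.single b 1) (Poly_Mapping.single c 1) =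
      g (Poly_Mapping.single b 1) (Poly_Mapping.single c 1)"
  shows "f p q = g p q"
proof (rule linear_from_pm_eq[OF assms(1,3)])
  show "f (Poly_Mapping.single b 1) q = g (Poly_Mapping.single b 1) q" for b
    by (rule linear_from_pm_eq[OF assms(2,4)]) (rule eq)
qed

lemma single_0_mult_pm: "Poly_Mapping.single 0 c * p = pm_scale c (p :: 'b::monoid_add \<Rightarrow>\<^sub>0 'k::field)"
  by (simp add: mult_map_scale_conv_mult pm_scale_def)

lemma pm_scale_mult_left: "pm_scale c p * q = pm_scale c (p * q)"
  for p q :: "'b::monoid_add \<Rightarrow>\<^sub>0 'k::field"
  by (simp add: single_0_mult_pm[symmetric] mult.assoc)

lemma mult_single_0: "p * Poly_Mapping.single 0 c = pm_scale c (p :: 'b::monoid_add \<Rightarrow>\<^sub>0 'k::field)"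
  by (rule linear_from_pm_eq[of pm_scale])
     (auto intro!: linearI_pm pm.vector_space_axioms
       simp: distrib_right pm_scale_mult_left mult_single pm.scale_right_distrib mult.commute)

lemma pm_scale_mult_right: "p * pm_scale c q = pm_scale c (p * q)"
  for p q :: "'b::monoid_add \<Rightarrow>\<^sub>0 'k::field"
  by (simp add: single_0_mult_pm[symmetric] mult.assoc[symmetric])
     (simp add: single_0_mult_pm mult_single_0)

text \<open>The relations by which the tensor product of \<open>V\<close> and \<open>W\<close> (with scalar
  multiplications \<open>s\<close> and \<open>t\<close>) is a quotient of the free vector space on \<open>V \<times> W\<close>.\<close>

definition tensor_relations ::
  "('k::field \<Rightarrow> 'v \<Rightarrow> 'v) \<Rightarrow> ('k \<Rightarrow> 'w \<Rightarrow> 'w) \<Rightarrow> ('v::ab_group_add \<times> 'w::ab_group_add \<Rightarrow>\<^sub>0 'k) set"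
  where "tensor_relations s t = pm.span (
    {Poly_Mapping.single (v + v', w) 1 - Poly_Mapping.single (v, w) 1 - Poly_Mapping.single (v', w) 1 | v v' w. True} \<union>
    {Poly_Mapping.single (v, w + w') 1 - Poly_Mapping.single (v, w) 1 - Poly_Mapping.single (v, w') 1 | v w w'. True} \<union>
    {Poly_Mapping.single (s c v, w) 1 - Poly_Mapping.single (v, w) c | c v w. True} \<union>
    {Poly_Mapping.single (v, t c w) 1 - Poly_Mapping.single (v, w) c | c v w. True})"

lemma equivp_span: "equivp (\<lambda>p q. p - q \<in> pm.span S)"
proof (rule equivpI)
  show "reflp (\<lambda>p q. p - q \<in> pm.span S)" by (auto intro!: reflpI pm.span_zero)
  show "symp (\<lambda>p q. p - q \<in> pm.span S)"
    using pm.span_neg by (force intro!: sympI)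
  show "transp (\<lambda>p q. p - q \<in> pm.span S)"
    by (rule transpI) (drule (1) pm.span_add, simp)
qed

lemma span_quotient_arith:
  assumes "p - p' \<in> pm.span S"
  shows "q - q' \<in> pm.span S \<Longrightarrow> (p + q) - (p' + q') \<in> pm.span S"
    and "q - q' \<in> pm.span S \<Longrightarrow> (p - q) - (p' - q') \<in> pm.span S"
    and "(- p) - (- p') \<in> pm.span S"
    and "pm_scale c p - pm_scale c p' \<in> pm.span S"
proof -
  show "q - q' \<in> pm.span S \<Longrightarrow> (p + q) - (p' + q') \<in> pm.span S"
    using pm.span_add[OF assms, of "q - q'"] by (simp add: algebra_simps)
  show "q - q' \<in> pm.span S \<Longrightarrow> (p - q) - (p' - q') \<in> pm.span S"
    using pm.span_diff[OF assms, of "q - q'"] by (simp add: algebra_simps)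
  show "(- p) - (- p') \<in> pm.span S"
    using pm.span_neg[OF assms] by simp
  show "pm_scale c p - pm_scale c p' \<in> pm.span S"
    using pm.span_scale[OF assms] by (simp add: pm.scale_right_diff_distrib)
qed

section \<open>The tensor algebra\<close>

datatype 'a word = Word (letters: "'a list")

instantiation word :: (type) monoid_add
begin
definition "0 = Word []"
definition "u + v = Word (letters u @ letters v)"
instance by standard (auto simp: zero_word_def plus_word_def)
end

datatype 'g symp = X 'g | Y 'g

text \<open>The symplectic space \<open>H\<close> is given in coordinates, as the space with basis \<open>x\<^sub>i, y\<^sub>i\<close>, where
  \<open>i\<close> ranges over a finite type with \<open>g\<close> elements. Then \<open>T(H)\<close> is the algebra of the monoid of words
  in these \<open>2g\<close> letters, with \<open>H\<close> as the subspace \<open>HH\<close> spanned by the letters, and \<open>T(H) \<otimes> T(H)\<close>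
  is the algebra of the monoid of pairs of words.\<close>

type_synonym ('g, 'k) tens = "'g symp word \<Rightarrow>\<^sub>0 'k"
type_synonym ('g, 'k) tens_sq = "'g symp word \<times> 'g symp word \<Rightarrow>\<^sub>0 'k"

definition var :: "'g symp \<Rightarrow> ('g, 'k::field) tens" where
  "var a = Poly_Mapping.single (Word [a]) 1"

definition HH :: "('g, 'k::field) tens set" where
  "HH = pm.span (range var)"

definition tens_deg :: "nat \<Rightarrow> ('g, 'k::field) tens set" where
  "tens_deg d = {p. \<forall>w \<in> Poly_Mapping.keys p. length (letters w) = d}"

definition bracket :: "'a::ring \<Rightarrow> 'a \<Rightarrow> 'a" where
  "bracket a b = a * b - b * a"

definition omega :: "('g::finite, 'k::field) tens" where
  "omega = (\<Sum>i\<in>UNIV. bracket (var (X i)) (var (Y i)))"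

definition omega_ideal :: "('g::finite, 'k::field) tens set" where
  "omega_ideal = pm.span {a * omega * b | a b. True}"

lemma zero_in_omega_ideal: "0 \<in> omega_ideal"
  unfolding omega_ideal_def by (rule pm.span_zero)

lemma omega_ideal_mult_left: "p \<in> omega_ideal \<Longrightarrow> a * p \<in> omega_ideal"
  unfolding omega_ideal_def
proof (induction rule: pm.span_induct_alt)
  case base
  show ?case by (simp add: pm.span_zero)
next
  case (step c x y)
  from step(1) obtain b d where x: "x = b * omega * d" by auto
  have "a * x \<in> {a * omega * b | a b. True}" unfolding x by (metis (mono_tags, lifting) mem_Collect_eq mult.assoc)
  then have "pm_scale c (a * x) + a * y \<in> pm.span {a * omega * b | a b. True}"
    using step(2) by (blast intro: pm.span_add pm.span_scale pm.span_base)
  then show ?case by (simp add: distrib_left pm_scale_mult_right)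
qed

lemma omega_ideal_mult_right: "p \<in> omega_ideal \<Longrightarrow> p * a \<in> omega_ideal"
  unfolding omega_ideal_def
proof (induction rule: pm.span_induct_alt)
  case base
  show ?case by (simp add: pm.span_zero)
next
  case (step c x y)
  from step(1) obtain b d where x: "x = b * omega * d" by auto
  have "x * a \<in> {a * omega * b | a b. True}" unfolding x by (metis (mono_tags, lifting) mem_Collect_eq mult.assoc)
  then have "pm_scale c (x * a) + y * a \<in> pm.span {a * omega * b | a b. True}"
    using step(2) by (blast intro: pm.span_add pm.span_scale pm.span_base)
  then show ?case by (simp add: distrib_right pm_scale_mult_left)
qed

lemma lookup_0_mult:
  "Poly_Mapping.lookup (p * q) 0 = Poly_Mapping.lookup p 0 * Poly_Mapping.lookup q 0"
  for p q :: "('g, 'k::field) tens"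
proof -
  have vs: "vector_space ((*) :: 'k \<Rightarrow> 'k \<Rightarrow> 'k)" by standard (auto simp: algebra_simps)
  show ?thesis
  proof (rule bilinear_from_pm_eq[of "(*)" "\<lambda>p q. Poly_Mapping.lookup (p * q) 0"
        "\<lambda>p q. Poly_Mapping.lookup p 0 * Poly_Mapping.lookup q 0"])
    fix u v :: "'g symp word"
    show "Poly_Mapping.lookup (Poly_Mapping.single u 1 * Poly_Mapping.single v 1) 0
      = Poly_Mapping.lookup (Poly_Mapping.single u 1) 0 * (Poly_Mapping.lookup (Poly_Mapping.single v 1) 0 :: 'k)"
      by (cases u; cases v) (auto simp: mult_single lookup_single when_def zero_word_def plus_word_def)
  qed (auto intro!: linearI_pm vs simp: distrib_left distrib_right lookup_add pm_scale_mult_left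
      pm_scale_mult_right algebra_simps)
qed

lemma one_notin_omega_ideal: "1 \<notin> (omega_ideal :: ('g::finite, 'k::field) tens set)"
proof -
  have "Poly_Mapping.lookup (omega :: ('g, 'k) tens) 0 = 0"
    by (simp add: omega_def bracket_def lookup_sum lookup_minus lookup_0_mult)
  then have gen: "Poly_Mapping.lookup (a * omega * b) 0 = 0" for a b :: "('g, 'k) tens"
    by (simp add: lookup_0_mult)
  have "Poly_Mapping.lookup p 0 = 0" if "p \<in> omega_ideal" for p :: "('g, 'k) tens"
    using that unfolding omega_ideal_def
    by (induction rule: pm.span_induct_alt) (auto simp: lookup_add gen)
  then show ?thesis by force
qed

quotient_type (overloaded) ('g, 'k) tens_omega =
  "('g::finite, 'k::field) tens" / "\<lambda>p q. p - q \<in> omega_ideal"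
  morphisms rep_omega to_omega
  unfolding omega_ideal_def by (rule equivp_span)

instantiation tens_omega :: (finite, field) ring_1
begin
lift_definition zero_tens_omega :: "('a, 'b) tens_omega" is 0 .
lift_definition one_tens_omega :: "('a, 'b) tens_omega" is 1 .
lift_definition plus_tens_omega :: "('a, 'b) tens_omega \<Rightarrow> ('a, 'b) tens_omega \<Rightarrow> ('a, 'b) tens_omega"
  is "(+)" unfolding omega_ideal_def by (rule span_quotient_arith)
lift_definition minus_tens_omega :: "('a, 'b) tens_omega \<Rightarrow> ('a, 'b) tens_omega \<Rightarrow> ('a, 'b) tens_omega"
  is "(-)" unfolding omega_ideal_def by (rule span_quotient_arith)
lift_definition uminus_tens_omega :: "('a, 'b) tens_omega \<Rightarrow> ('a, 'b) tens_omega"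
  is uminus unfolding omega_ideal_def by (rule span_quotient_arith)
lift_definition times_tens_omega :: "('a, 'b) tens_omega \<Rightarrow> ('a, 'b) tens_omega \<Rightarrow> ('a, 'b) tens_omega"
  is "(*)"
proof -
  fix p p' q q' :: "('a, 'b) tens"
  assume "p - p' \<in> omega_ideal" "q - q' \<in> omega_ideal"
  then have "(p - p') * q + p' * (q - q') \<in> omega_ideal"
    using omega_ideal_mult_left omega_ideal_mult_right pm.span_add unfolding omega_ideal_def by blast
  then show "p * q - p' * q' \<in> omega_ideal" by (simp add: algebra_simps)
qed
instance
proof
  fix a b c :: "('a, 'b) tens_omega"
  show "a + b + c = a + (b + c)" by transfer (simp add: zero_in_omega_ideal)
  show "a + b = b + a" by transfer (simp add: zero_in_omega_ideal)
  show "0 + a = a" by transfer (simp add: zero_in_omega_ideal)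
  show "- a + a = 0" by transfer (simp add: zero_in_omega_ideal)
  show "a - b = a + - b" by transfer (simp add: zero_in_omega_ideal)
  show "a * b * c = a * (b * c)" by transfer (simp add: zero_in_omega_ideal mult.assoc)
  show "1 * a = a" by transfer (simp add: zero_in_omega_ideal)
  show "a * 1 = a" by transfer (simp add: zero_in_omega_ideal)
  show "(a + b) * c = a * c + b * c" by transfer (simp add: zero_in_omega_ideal distrib_right)
  show "a * (b + c) = a * b + a * c" by transfer (simp add: zero_in_omega_ideal distrib_left)
  show "(0 :: ('a, 'b) tens_omega) \<noteq> 1"
  proof transfer
    show "(0 :: ('a, 'b) tens) - 1 \<notin> omega_ideal"
      using one_notin_omega_ideal pm.span_neg[of "0 - 1 :: ('a, 'b) tens"]
      unfolding omega_ideal_def by auto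
  qed
qed
end

lift_definition scale_omega :: "'k \<Rightarrow> ('g::finite, 'k::field) tens_omega \<Rightarrow> ('g, 'k) tens_omega"
  is pm_scale unfolding omega_ideal_def by (rule span_quotient_arith)

global_interpretation omega: vector_space scale_omega
  by standard (transfer; simp add: omega_ideal_def pm.span_zero pm.scale_right_distrib pm.scale_left_distrib)+

lemma to_omega_eq_iff: "to_omega p = to_omega q \<longleftrightarrow> p - q \<in> omega_ideal"
  by (rule tens_omega.abs_eq_iff)

lemma linear_to_omega: "Vector_Spaces.linear pm_scale scale_omega to_omega"
  by (rule linearI_pm)
     (simp_all add: omega.vector_space_axioms plus_tens_omega.abs_eq scale_omega.abs_eq)

lemma scale_omega_mult:
  "scale_omega c (a * b) = scale_omega c a * b" "scale_omega c (a * b) = a * scale_omega c b"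
  by (transfer; simp add: pm_scale_mult_left pm_scale_mult_right omega_ideal_def pm.span_zero)+

section \<open>Trace spaces\<close>

text \<open>Since the negative of a commutator is a commutator, \<open>comm_span\<close> is the additive subgroup
  generated by the commutators. In an algebra over a field it is their linear span, because
  \<open>c [a, b] = [c a, b]\<close>.\<close>

inductive_set comm_span :: "'a::ring set" where
  zero: "0 \<in> comm_span"
| add: "p \<in> comm_span \<Longrightarrow> bracket a b + p \<in> comm_span"

lemma comm_span_bracket: "bracket a b \<in> comm_span"
  using comm_span.add[OF comm_span.zero] by simp

lemma comm_span_add: "p \<in> comm_span \<Longrightarrow> q \<in> comm_span \<Longrightarrow> p + q \<in> comm_span"
  by (induction rule: comm_span.induct) (auto simp: add.assoc intro: comm_span.add)

lemma comm_span_minus: "p \<in> comm_span \<Longrightarrow> - p \<in> comm_span"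
proof (induction rule: comm_span.induct)
  case (add p a b)
  have "- (bracket a b + p) = bracket b a + - p" by (simp add: bracket_def)
  then show ?case using comm_span.add[OF add(2)] by metis
qed (auto intro: comm_span.zero)

lemma comm_span_diff: "p \<in> comm_span \<Longrightarrow> q \<in> comm_span \<Longrightarrow> p - q \<in> comm_span"
  using comm_span_add[OF _ comm_span_minus] by fastforce

quotient_type (overloaded) 'a trace = "'a::ring" / "\<lambda>a b. a - b \<in> comm_span"
  morphisms rep_trace tr
proof (rule equivpI)
  show "reflp (\<lambda>a b::'a. a - b \<in> comm_span)" by (auto intro!: reflpI comm_span.zero)
  show "symp (\<lambda>a b::'a. a - b \<in> comm_span)"
    using comm_span_minus by (force intro!: sympI)
  show "transp (\<lambda>a b::'a. a - b \<in> comm_span)"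
    by (rule transpI) (drule (1) comm_span_add, simp)
qed

instantiation trace :: (ring) ab_group_add
begin
lift_definition zero_trace :: "'a trace" is 0 .
lift_definition plus_trace :: "'a trace \<Rightarrow> 'a trace \<Rightarrow> 'a trace" is "(+)"
  by (drule (1) comm_span_add) (simp add: algebra_simps)
lift_definition minus_trace :: "'a trace \<Rightarrow> 'a trace \<Rightarrow> 'a trace" is "(-)"
  by (drule (1) comm_span_diff) (simp add: algebra_simps)
lift_definition uminus_trace :: "'a trace \<Rightarrow> 'a trace" is uminus
  by (drule comm_span_minus) simp
instance by standard (transfer; simp add: comm_span.zero algebra_simps)+
end

lemma tr_eq_iff: "tr a = tr b \<longleftrightarrow> a - b \<in> comm_span"
  by (rule trace.abs_eq_iff)

lemma tr_mult_commute: "tr (a * b) = tr (b * a)"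
  using comm_span_bracket by (simp add: tr_eq_iff bracket_def)

lemma comm_span_scale:
  assumes "\<And>a b. s (a + b) = s a + s b" "\<And>a b. s (a * b) = s a * b" "\<And>a b. s (a * b) = a * s b"
    and "p \<in> comm_span"
  shows "s p \<in> comm_span"
proof -
  have z: "s 0 = 0" using assms(1)[of 0 0] by simp
  have m: "s (- a) = - s a" for a using assms(1)[of a "- a"] z by (metis add.inverse_unique add.right_inverse)
  have "s (bracket a b) = bracket (s a) b" for a b
    unfolding bracket_def using assms(1)[of "a * b" "- (b * a)"] assms(2,3) by (simp add: m)
  with assms(4) show ?thesis
    by (induction rule: comm_span.induct) (auto simp: z assms(1) intro: comm_span.intros)
qed

lift_definition scale_trace :: "'k \<Rightarrow> ('b::monoid_add \<Rightarrow>\<^sub>0 'k::field) trace \<Rightarrow> ('b \<Rightarrow>\<^sub>0 'k) trace"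
  is pm_scale
  by (subst pm.scale_right_diff_distrib[symmetric], rule comm_span_scale)
     (simp_all add: pm.scale_right_distrib pm_scale_mult_left pm_scale_mult_right)

global_interpretation trace: vector_space scale_trace
  by standard (transfer; simp add: comm_span.zero pm.scale_right_distrib pm.scale_left_distrib)+

lift_definition scale_trace_omega ::
  "'k \<Rightarrow> ('g::finite, 'k::field) tens_omega trace \<Rightarrow> ('g, 'k) tens_omega trace"
  is scale_omega
  by (subst omega.scale_right_diff_distrib[symmetric], rule comm_span_scale)
     (simp_all add: omega.scale_right_distrib flip: scale_omega_mult)

global_interpretation trace_omega: vector_space scale_trace_omega
  by standard (transfer; simp add: comm_span.zero omega.scale_right_distrib omega.scale_left_distrib)+

text \<open>For subspaces \<open>Z1\<close>, \<open>Z2\<close> of an algebra with scalar multiplication \<open>s\<close>, this is \<open>|Z1 Z2|\<close>.\<close>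

definition trace_prod :: "('k::field \<Rightarrow> 'a \<Rightarrow> 'a) \<Rightarrow> 'a set \<Rightarrow> 'a set \<Rightarrow> 'a::ring trace set" where
  "trace_prod s Z1 Z2 = tr ` module.span s {a * b | a b. a \<in> Z1 \<and> b \<in> Z2}"

definition trace_omega_deg :: "nat \<Rightarrow> ('g::finite, 'k::field) tens_omega trace set" where
  "trace_omega_deg d = (\<lambda>p. tr (to_omega p)) ` tens_deg d"

section \<open>Tensor squares\<close>

quotient_type (overloaded) ('g, 'k) tens_omega_sq =
  "('g::finite, 'k::field) tens_omega \<times> ('g, 'k) tens_omega \<Rightarrow>\<^sub>0 'k"
  / "\<lambda>p q. p - q \<in> tensor_relations scale_omega scale_omega"
  morphisms rep_omega_sq abs_omega_sq
  unfolding tensor_relations_def by (rule equivp_span)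

instantiation tens_omega_sq :: (finite, field) ab_group_add
begin
lift_definition zero_tens_omega_sq :: "('a, 'b) tens_omega_sq" is 0 .
lift_definition plus_tens_omega_sq ::
  "('a, 'b) tens_omega_sq \<Rightarrow> ('a, 'b) tens_omega_sq \<Rightarrow> ('a, 'b) tens_omega_sq"
  is "(+)" unfolding tensor_relations_def by (rule span_quotient_arith)
lift_definition minus_tens_omega_sq ::
  "('a, 'b) tens_omega_sq \<Rightarrow> ('a, 'b) tens_omega_sq \<Rightarrow> ('a, 'b) tens_omega_sq"
  is "(-)" unfolding tensor_relations_def by (rule span_quotient_arith)
lift_definition uminus_tens_omega_sq :: "('a, 'b) tens_omega_sq \<Rightarrow> ('a, 'b) tens_omega_sq"
  is uminus unfolding tensor_relations_def by (rule span_quotient_arith)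
instance
  by standard (transfer; simp add: tensor_relations_def pm.span_zero)+
end

lift_definition scale_omega_sq :: "'k \<Rightarrow> ('g::finite, 'k::field) tens_omega_sq \<Rightarrow> ('g, 'k) tens_omega_sq"
  is pm_scale unfolding tensor_relations_def by (rule span_quotient_arith)

global_interpretation omega_sq: vector_space scale_omega_sq
  by standard (transfer; simp add: tensor_relations_def pm.span_zero pm.scale_right_distrib pm.scale_left_distrib)+

definition tensor_omega ::
  "('g::finite, 'k::field) tens_omega \<Rightarrow> ('g, 'k) tens_omega \<Rightarrow> ('g, 'k) tens_omega_sq" where
  "tensor_omega a b = abs_omega_sq (Poly_Mapping.single (a, b) 1)"

lemma tensor_relations_bilinear:
  "Poly_Mapping.single (v + v', w) 1 - (Poly_Mapping.single (v, w) 1 + Poly_Mapping.single (v', w) 1) \<in> tensor_relations s t"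
  "Poly_Mapping.single (v, w + w') 1 - (Poly_Mapping.single (v, w) 1 + Poly_Mapping.single (v, w') 1) \<in> tensor_relations s t"
  "Poly_Mapping.single (s c v, w) 1 - Poly_Mapping.single (v, w) c \<in> tensor_relations s t"
  "Poly_Mapping.single (v, t c w) 1 - Poly_Mapping.single (v, w) c \<in> tensor_relations s t"
  unfolding tensor_relations_def by (rule pm.span_base; force simp: algebra_simps)+

lemma tensor_omega_bilinear:
  "tensor_omega (a + a') b = tensor_omega a b + tensor_omega a' b"
  "tensor_omega a (b + b') = tensor_omega a b + tensor_omega a b'"
  "tensor_omega (scale_omega c a) b = scale_omega_sq c (tensor_omega a b)"
  "tensor_omega a (scale_omega c b) = scale_omega_sq c (tensor_omega a b)"
  unfolding tensor_omega_def
  by (simp_all add: plus_tens_omega_sq.abs_eq scale_omega_sq.abs_eq tens_omega_sq.abs_eq_iff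
      tensor_relations_bilinear)

quotient_type (overloaded) ('g, 'k) trace_omega_sq =
  "('g::finite, 'k::field) tens_omega trace \<times> ('g, 'k) tens_omega trace \<Rightarrow>\<^sub>0 'k"
  / "\<lambda>p q. p - q \<in> tensor_relations scale_trace_omega scale_trace_omega"
  morphisms rep_trace_sq abs_trace_sq
  unfolding tensor_relations_def by (rule equivp_span)

instantiation trace_omega_sq :: (finite, field) ab_group_add
begin
lift_definition zero_trace_omega_sq :: "('a, 'b) trace_omega_sq" is 0 .
lift_definition plus_trace_omega_sq ::
  "('a, 'b) trace_omega_sq \<Rightarrow> ('a, 'b) trace_omega_sq \<Rightarrow> ('a, 'b) trace_omega_sq"
  is "(+)" unfolding tensor_relations_def by (rule span_quotient_arith)
lift_definition minus_trace_omega_sq ::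
  "('a, 'b) trace_omega_sq \<Rightarrow> ('a, 'b) trace_omega_sq \<Rightarrow> ('a, 'b) trace_omega_sq"
  is "(-)" unfolding tensor_relations_def by (rule span_quotient_arith)
lift_definition uminus_trace_omega_sq :: "('a, 'b) trace_omega_sq \<Rightarrow> ('a, 'b) trace_omega_sq"
  is uminus unfolding tensor_relations_def by (rule span_quotient_arith)
instance
  by standard (transfer; simp add: tensor_relations_def pm.span_zero)+
end

lift_definition scale_trace_sq :: "'k \<Rightarrow> ('g::finite, 'k::field) trace_omega_sq \<Rightarrow> ('g, 'k) trace_omega_sq"
  is pm_scale unfolding tensor_relations_def by (rule span_quotient_arith)

global_interpretation trace_sq: vector_space scale_trace_sq
  by standard (transfer; simp add: tensor_relations_def pm.span_zero pm.scale_right_distrib pm.scale_left_distrib)+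

definition tensor_trace ::
  "('g::finite, 'k::field) tens_omega trace \<Rightarrow> ('g, 'k) tens_omega trace \<Rightarrow> ('g, 'k) trace_omega_sq" where
  "tensor_trace a b = abs_trace_sq (Poly_Mapping.single (a, b) 1)"

lemma tensor_trace_bilinear:
  "tensor_trace (a + a') b = tensor_trace a b + tensor_trace a' b"
  "tensor_trace a (b + b') = tensor_trace a b + tensor_trace a b'"
  "tensor_trace (scale_trace_omega c a) b = scale_trace_sq c (tensor_trace a b)"
  "tensor_trace a (scale_trace_omega c b) = scale_trace_sq c (tensor_trace a b)"
  unfolding tensor_trace_def
  by (simp_all add: plus_trace_omega_sq.abs_eq scale_trace_sq.abs_eq trace_omega_sq.abs_eq_iff
      tensor_relations_bilinear)

text \<open>The canonical projections from \<open>T(H) \<otimes> T(H)\<close> to \<open>T(H)\<^sub>\<omega> \<otimes> T(H)\<^sub>\<omega>\<close> and from there to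
  \<open>|T(H)\<^sub>\<omega>| \<otimes> |T(H)\<^sub>\<omega>|\<close>.\<close>

definition to_omega_sq :: "('g::finite, 'k::field) tens_sq \<Rightarrow> ('g, 'k) tens_omega_sq" where
  "to_omega_sq = lin_ext scale_omega_sq
    (\<lambda>(u, v). tensor_omega (to_omega (Poly_Mapping.single u 1)) (to_omega (Poly_Mapping.single v 1)))"

definition omega_sq_to_trace_sq :: "('g::finite, 'k::field) tens_omega_sq \<Rightarrow> ('g, 'k) trace_omega_sq" where
  "omega_sq_to_trace_sq z =
    lin_ext scale_trace_sq (\<lambda>(a, b). tensor_trace (tr a) (tr b)) (rep_omega_sq z)"

lemma linear_to_omega_sq: "Vector_Spaces.linear pm_scale scale_omega_sq to_omega_sq"
  unfolding to_omega_sq_def by (rule linear_lin_ext) (rule omega_sq.vector_space_axioms)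

lemma omega_sq_to_trace_sq_abs:
  "omega_sq_to_trace_sq (abs_omega_sq p) = lin_ext scale_trace_sq (\<lambda>(a, b). tensor_trace (tr a) (tr b)) p"
proof -
  let ?L = "lin_ext scale_trace_sq (\<lambda>(a, b). tensor_trace (tr a) (tr b)) ::
    (('a, 'b) tens_omega \<times> ('a, 'b) tens_omega \<Rightarrow>\<^sub>0 'b) \<Rightarrow> _"
  interpret L: Vector_Spaces.linear pm_scale scale_trace_sq ?L
    by (rule linear_lin_ext) (rule trace_sq.vector_space_axioms)
  note [simp] = lin_ext_single[OF trace_sq.vector_space_axioms]
  have "?L q = 0" if "q \<in> tensor_relations scale_omega scale_omega" for q
    using that unfolding tensor_relations_def
  proof (induction rule: pm.span_induct_alt)
    case (step c x y)
    from step(1) have "?L x = 0"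
      by (auto simp: L.diff tensor_trace_bilinear simp flip: plus_trace.abs_eq scale_trace_omega.abs_eq)
    with step(2) show ?case by (simp add: L.add L.scale)
  qed simp
  moreover have "abs_omega_sq (rep_omega_sq (abs_omega_sq p)) = abs_omega_sq p"
    by (rule Quotient3_abs_rep[OF Quotient3_tens_omega_sq])
  ultimately have "?L (rep_omega_sq (abs_omega_sq p) - p) = 0"
    by (simp add: tens_omega_sq.abs_eq_iff)
  then show ?thesis by (simp add: L.diff omega_sq_to_trace_sq_def)
qed

lemma omega_sq_to_trace_sq_tensor: "omega_sq_to_trace_sq (tensor_omega a b) = tensor_trace (tr a) (tr b)"
  by (simp add: tensor_omega_def omega_sq_to_trace_sq_abs lin_ext_single[OF trace_sq.vector_space_axioms])

lemma omega_sq_to_trace_sq_add: "omega_sq_to_trace_sq (y + z) = omega_sq_to_trace_sq y + omega_sq_to_trace_sq z"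
  and omega_sq_to_trace_sq_scale: "omega_sq_to_trace_sq (scale_omega_sq c z) = scale_trace_sq c (omega_sq_to_trace_sq z)"
proof -
  interpret L: Vector_Spaces.linear pm_scale scale_trace_sq
    "lin_ext scale_trace_sq (\<lambda>(a, b). tensor_trace (tr a) (tr b)) ::
      (('a, 'b) tens_omega \<times> ('a, 'b) tens_omega \<Rightarrow>\<^sub>0 'b) \<Rightarrow> _"
    by (rule linear_lin_ext) (rule trace_sq.vector_space_axioms)
  show "omega_sq_to_trace_sq (y + z) = omega_sq_to_trace_sq y + omega_sq_to_trace_sq z"
    by (induction y rule: tens_omega_sq.abs_induct, induction z rule: tens_omega_sq.abs_induct)
      (simp add: plus_tens_omega_sq.abs_eq omega_sq_to_trace_sq_abs L.add)
  show "omega_sq_to_trace_sq (scale_omega_sq c z) = scale_trace_sq c (omega_sq_to_trace_sq z)"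
    by (induction z rule: tens_omega_sq.abs_induct)
      (simp add: scale_omega_sq.abs_eq omega_sq_to_trace_sq_abs L.scale)
qed

lemma linear_omega_sq_to_trace_sq:
  "Vector_Spaces.linear scale_omega_sq scale_trace_sq omega_sq_to_trace_sq"
  unfolding linear_iff_module_hom module_hom_iff
  by (simp add: module_iff_vector_space omega_sq.vector_space_axioms trace_sq.vector_space_axioms
      omega_sq_to_trace_sq_add omega_sq_to_trace_sq_scale)

section \<open>The coproduct\<close>

text \<open>The coproduct of \<open>T(H)\<close> is the algebra homomorphism with \<open>a \<mapsto> a \<otimes> 1 + 1 \<otimes> a\<close> for each letter
  \<open>a\<close>, hence on a word it is the product of these elements. The coproduct of \<open>T(H)\<^sub>\<omega>\<close> is induced by
  it.\<close>

definition coprod :: "('g, 'k::field) tens \<Rightarrow> ('g, 'k) tens_sq" where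
  "coprod = lin_ext pm_scale
    (\<lambda>w. \<Prod>a\<leftarrow>letters w. Poly_Mapping.single (Word [a], 0) 1 + Poly_Mapping.single (0, Word [a]) 1)"

definition coprod_omega :: "('g::finite, 'k::field) tens_omega \<Rightarrow> ('g, 'k) tens_omega_sq" where
  "coprod_omega a = to_omega_sq (coprod (rep_omega a))"

definition red_coprod_omega :: "('g::finite, 'k::field) tens_omega \<Rightarrow> ('g, 'k) tens_omega_sq" where
  "red_coprod_omega a = coprod_omega a - tensor_omega a 1 - tensor_omega 1 a"

definition trace_red_coprod :: "('g::finite, 'k::field) tens_omega trace \<Rightarrow> ('g, 'k) trace_omega_sq" where
  "trace_red_coprod t = omega_sq_to_trace_sq (red_coprod_omega (rep_trace t))"

text \<open>These maps do not depend on the chosen representatives: see \<open>coprod_omega_to_omega\<close> and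
  \<open>trace_red_coprod_tr\<close> below, and \<open>omega_sq_to_trace_sq_abs\<close> above.\<close>

lemma linear_coprod: "Vector_Spaces.linear pm_scale pm_scale coprod"
  unfolding coprod_def by (rule linear_lin_ext) (rule pm.vector_space_axioms)

interpretation coprod: Vector_Spaces.linear pm_scale pm_scale coprod
  by (rule linear_coprod)

interpretation to_omega: Vector_Spaces.linear pm_scale scale_omega to_omega
  by (rule linear_to_omega)

interpretation to_omega_sq: Vector_Spaces.linear pm_scale scale_omega_sq to_omega_sq
  by (rule linear_to_omega_sq)

interpretation omega_sq_to_trace_sq: Vector_Spaces.linear scale_omega_sq scale_trace_sq omega_sq_to_trace_sq
  by (rule linear_omega_sq_to_trace_sq)

lemma coprod_var: "coprod (var a) = Poly_Mapping.single (Word [a], 0) 1 + Poly_Mapping.single (0, Word [a]) 1"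
  by (simp add: coprod_def var_def lin_ext_single[OF pm.vector_space_axioms])

lemma coprod_mult: "coprod (p * q) = coprod p * coprod q"
proof (rule bilinear_from_pm_eq[of pm_scale "\<lambda>p q. coprod (p * q)" "\<lambda>p q. coprod p * coprod q"])
  fix u v :: "'a symp word"
  show "coprod (Poly_Mapping.single u 1 * Poly_Mapping.single v 1) =
      coprod (Poly_Mapping.single u 1) * (coprod (Poly_Mapping.single v 1) :: ('a, 'b) tens_sq)"
    by (simp add: mult_single coprod_def lin_ext_single[OF pm.vector_space_axioms] plus_word_def)
qed (auto intro!: linearI_pm pm.vector_space_axioms simp: distrib_left distrib_right coprod.add
    coprod.scale pm_scale_mult_left pm_scale_mult_right)

definition left_factor :: "('g, 'k::field) tens \<Rightarrow> ('g, 'k) tens_sq" where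
  "left_factor = lin_ext pm_scale (\<lambda>u. Poly_Mapping.single (u, 0) 1)"

definition right_factor :: "('g, 'k::field) tens \<Rightarrow> ('g, 'k) tens_sq" where
  "right_factor = lin_ext pm_scale (\<lambda>u. Poly_Mapping.single (0, u) 1)"

interpretation left_factor: Vector_Spaces.linear pm_scale pm_scale left_factor
  unfolding left_factor_def by (rule linear_lin_ext) (rule pm.vector_space_axioms)

interpretation right_factor: Vector_Spaces.linear pm_scale pm_scale right_factor
  unfolding right_factor_def by (rule linear_lin_ext) (rule pm.vector_space_axioms)

lemma left_factor_single: "left_factor (Poly_Mapping.single u 1) = Poly_Mapping.single (u, 0) 1"
  and right_factor_single: "right_factor (Poly_Mapping.single u 1) = Poly_Mapping.single (0, u) 1"
  by (simp_all add: left_factor_def right_factor_def lin_ext_single[OF pm.vector_space_axioms])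

lemma coprod_omega_element: "coprod omega = left_factor omega + right_factor omega"
proof -
  have "coprod (bracket (var a) (var b)) =
      left_factor (bracket (var a) (var b)) + right_factor (bracket (var a) (var b) :: ('a, 'b) tens)" for a b
    by (simp add: bracket_def coprod.diff coprod_mult coprod_var left_factor.diff right_factor.diff)
      (simp add: var_def mult_single left_factor_def right_factor_def zero_word_def
        lin_ext_single[OF pm.vector_space_axioms] plus_word_def algebra_simps)
  then show ?thesis
    by (simp add: omega_def coprod.sum left_factor.sum right_factor.sum sum.distrib)
qed

lemma to_omega_sq_single:
  "to_omega_sq (Poly_Mapping.single (u, v) 1) =
    tensor_omega (to_omega (Poly_Mapping.single u 1)) (to_omega (Poly_Mapping.single v 1))"
  by (simp add: to_omega_sq_def lin_ext_single[OF omega_sq.vector_space_axioms])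

lemma to_omega_sq_left_factor:
  "to_omega_sq (Poly_Mapping.single (u, v) 1 * left_factor p * Poly_Mapping.single (u', v') 1) =
    tensor_omega (to_omega (Poly_Mapping.single u 1 * p * Poly_Mapping.single u' 1))
      (to_omega (Poly_Mapping.single (v + v') 1))"
  by (rule linear_from_pm_eq[of scale_omega_sq
      "\<lambda>p. to_omega_sq (Poly_Mapping.single (u, v) 1 * left_factor p * Poly_Mapping.single (u', v') 1)"
      "\<lambda>p. tensor_omega (to_omega (Poly_Mapping.single u 1 * p * Poly_Mapping.single u' 1))
        (to_omega (Poly_Mapping.single (v + v') 1))"])
    (auto intro!: linearI_pm omega_sq.vector_space_axioms simp: distrib_left distrib_right
      left_factor.add left_factor.scale to_omega_sq.add to_omega_sq.scale to_omega.add to_omega.scale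
      tensor_omega_bilinear pm_scale_mult_left pm_scale_mult_right left_factor_single
      mult_single to_omega_sq_single)

lemma to_omega_sq_right_factor:
  "to_omega_sq (Poly_Mapping.single (u, v) 1 * right_factor p * Poly_Mapping.single (u', v') 1) =
    tensor_omega (to_omega (Poly_Mapping.single (u + u') 1))
      (to_omega (Poly_Mapping.single v 1 * p * Poly_Mapping.single v' 1))"
  by (rule linear_from_pm_eq[of scale_omega_sq
      "\<lambda>p. to_omega_sq (Poly_Mapping.single (u, v) 1 * right_factor p * Poly_Mapping.single (u', v') 1)"
      "\<lambda>p. tensor_omega (to_omega (Poly_Mapping.single (u + u') 1))
        (to_omega (Poly_Mapping.single v 1 * p * Poly_Mapping.single v' 1))"])
    (auto intro!: linearI_pm omega_sq.vector_space_axioms simp: distrib_left distrib_right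
      right_factor.add right_factor.scale to_omega_sq.add to_omega_sq.scale to_omega.add to_omega.scale
      tensor_omega_bilinear pm_scale_mult_left pm_scale_mult_right right_factor_single
      mult_single to_omega_sq_single)

lemma to_omega_ideal: "p \<in> omega_ideal \<Longrightarrow> to_omega p = 0"
  using to_omega_eq_iff[of p 0] by (simp add: to_omega.zero)

lemma tensor_omega_zero: "tensor_omega 0 b = 0" "tensor_omega a 0 = 0"
  using tensor_omega_bilinear(1)[of 0 0 b] tensor_omega_bilinear(2)[of a 0 0] by simp_all

lemma to_omega_sq_coprod_omega: "to_omega_sq (y * coprod omega * z) = 0"
proof (rule bilinear_from_pm_eq[of scale_omega_sq "\<lambda>y z. to_omega_sq (y * coprod omega * z)" "\<lambda>_ _. 0"])
  fix b c :: "'a symp word \<times> 'a symp word"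
  have "a * omega * d \<in> omega_ideal" for a d :: "('a, 'b) tens"
    unfolding omega_ideal_def by (rule pm.span_base) auto
  then show "to_omega_sq (Poly_Mapping.single b 1 * coprod omega * Poly_Mapping.single c 1) = (0 :: ('a, 'b) tens_omega_sq)"
    by (cases b; cases c) (simp add: coprod_omega_element distrib_left distrib_right to_omega_sq.add
        to_omega_sq_left_factor to_omega_sq_right_factor to_omega_ideal tensor_omega_zero)
qed (auto intro!: linearI_pm omega_sq.vector_space_axioms simp: distrib_left distrib_right to_omega_sq.add
    to_omega_sq.scale pm_scale_mult_left pm_scale_mult_right)

lemma coprod_omega_to_omega: "coprod_omega (to_omega p) = to_omega_sq (coprod p)"
proof -
  have "to_omega_sq (coprod q) = 0" if "q \<in> omega_ideal" for q :: "('a, 'b) tens"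
    using that unfolding omega_ideal_def
    by (induction rule: pm.span_induct_alt)
      (auto simp: coprod.add coprod.scale to_omega_sq.add to_omega_sq.scale coprod_mult
        to_omega_sq_coprod_omega)
  moreover have "to_omega (rep_omega (to_omega p)) = to_omega p"
    by (rule Quotient3_abs_rep[OF Quotient3_tens_omega])
  ultimately have "to_omega_sq (coprod (rep_omega (to_omega p) - p)) = 0"
    by (simp add: to_omega_eq_iff)
  then show ?thesis by (simp add: coprod.diff to_omega_sq.diff coprod_omega_def)
qed

lemma to_trace_sq_mult_commute:
  "omega_sq_to_trace_sq (to_omega_sq (y * z)) = omega_sq_to_trace_sq (to_omega_sq (z * y))"
proof (rule bilinear_from_pm_eq[of scale_trace_sq
      "\<lambda>y z. omega_sq_to_trace_sq (to_omega_sq (y * z))" "\<lambda>y z. omega_sq_to_trace_sq (to_omega_sq (z * y))"])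
  fix b c :: "'a symp word \<times> 'a symp word"
  have *: "tr (to_omega (Poly_Mapping.single (u + v) 1)) = tr (to_omega (Poly_Mapping.single (v + u) 1 :: ('a, 'b) tens))"
    for u v :: "'a symp word"
    using tr_mult_commute[of "to_omega (Poly_Mapping.single u 1)" "to_omega (Poly_Mapping.single v 1 :: ('a, 'b) tens)"]
    by (simp add: times_tens_omega.abs_eq mult_single)
  show "omega_sq_to_trace_sq (to_omega_sq (Poly_Mapping.single b 1 * Poly_Mapping.single c 1)) =
      (omega_sq_to_trace_sq (to_omega_sq (Poly_Mapping.single c 1 * Poly_Mapping.single b 1)) :: ('a, 'b) trace_omega_sq)"
    using *[of "fst b" "fst c"] *[of "snd b" "snd c"]
    by (cases b; cases c) (simp add: mult_single to_omega_sq_single omega_sq_to_trace_sq_tensor)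
qed (auto intro!: linearI_pm trace_sq.vector_space_axioms simp: distrib_left distrib_right to_omega_sq.add
    to_omega_sq.scale pm_scale_mult_left pm_scale_mult_right omega_sq_to_trace_sq.add omega_sq_to_trace_sq.scale)

lemma trace_red_coprod_tr: "trace_red_coprod (tr a) = omega_sq_to_trace_sq (red_coprod_omega a)"
proof -
  let ?f = "\<lambda>a :: ('a, 'b) tens_omega. omega_sq_to_trace_sq (red_coprod_omega a)"
  have co_add: "coprod_omega (a + b) = coprod_omega a + coprod_omega b" for a b :: "('a, 'b) tens_omega"
    by (induction a rule: tens_omega.abs_induct, induction b rule: tens_omega.abs_induct)
      (simp add: coprod_omega_to_omega coprod.add to_omega_sq.add flip: to_omega.add)
  have f_add: "?f (a + b) = ?f a + ?f b" for a b
    by (simp add: red_coprod_omega_def co_add tensor_omega_bilinear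
        omega_sq_to_trace_sq.add omega_sq_to_trace_sq.diff)
  have f_zero: "?f 0 = 0" using f_add[of 0 0] by simp
  have f_diff: "?f (a - b) = ?f a - ?f b" for a b using f_add[of "a - b" b] by simp
  have f_comm: "?f (a * b) = ?f (b * a)" for a b
  proof (induction a rule: tens_omega.abs_induct, induction b rule: tens_omega.abs_induct)
    fix p q :: "('a, 'b) tens"
    show "?f (to_omega q * to_omega p) = ?f (to_omega p * to_omega q)"
      by (simp add: red_coprod_omega_def omega_sq_to_trace_sq.diff omega_sq_to_trace_sq_tensor
          tr_mult_commute[of "to_omega q"])
        (simp add: times_tens_omega.abs_eq coprod_omega_to_omega coprod_mult
          to_trace_sq_mult_commute[of "coprod q"])
  qed
  have "?f x = 0" if "x \<in> comm_span" for x
    using that by (induction rule: comm_span.induct) (simp_all add: f_zero f_add f_diff f_comm bracket_def)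
  moreover have "tr (rep_trace (tr a)) = tr a"
    by (rule Quotient3_abs_rep[OF Quotient3_trace])
  ultimately have "?f (rep_trace (tr a) - a) = 0" by (simp add: tr_eq_iff)
  then show ?thesis by (simp add: f_diff trace_red_coprod_def)
qed

definition Ker_deg :: "nat \<Rightarrow> ('g::finite, 'k::field) tens_omega trace set" where
  "Ker_deg d = {t \<in> trace_omega_deg d. trace_red_coprod t = 0}"

section \<open>Free Lie algebras\<close>

text \<open>The free Lie algebra \<open>L(H)\<close> is the Lie subalgebra of \<open>T(H)\<close> generated by \<open>H\<close>.\<close>

inductive_set free_lie :: "('g, 'k::field) tens set" where
  gen: "h \<in> HH \<Longrightarrow> h \<in> free_lie"
| add: "p \<in> free_lie \<Longrightarrow> q \<in> free_lie \<Longrightarrow> p + q \<in> free_lie"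
| scale: "p \<in> free_lie \<Longrightarrow> pm_scale c p \<in> free_lie"
| bracket: "p \<in> free_lie \<Longrightarrow> q \<in> free_lie \<Longrightarrow> bracket p q \<in> free_lie"

inductive_set lie_ideal :: "('g::finite, 'k::field) tens set" where
  omega: "omega \<in> lie_ideal"
| add: "p \<in> lie_ideal \<Longrightarrow> q \<in> lie_ideal \<Longrightarrow> p + q \<in> lie_ideal"
| scale: "p \<in> lie_ideal \<Longrightarrow> pm_scale c p \<in> lie_ideal"
| bracket: "p \<in> free_lie \<Longrightarrow> q \<in> lie_ideal \<Longrightarrow> bracket p q \<in> lie_ideal"

lemma zero_in_free_lie: "0 \<in> free_lie"
  by (rule free_lie.gen) (simp add: HH_def pm.span_zero)

lemma zero_in_lie_ideal: "0 \<in> lie_ideal"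
  using lie_ideal.scale[OF lie_ideal.omega, of 0] by simp

lemma lie_ideal_minus: "p \<in> lie_ideal \<Longrightarrow> - p \<in> lie_ideal"
  using lie_ideal.scale[of p "- 1"] by simp

lemma lie_ideal_le_omega_ideal: "p \<in> lie_ideal \<Longrightarrow> p \<in> omega_ideal"
proof (induction rule: lie_ideal.induct)
  case omega
  have "1 * omega * 1 \<in> omega_ideal" unfolding omega_ideal_def by (rule pm.span_base) blast
  then show ?case by simp
next
  case (bracket p q)
  then have "p * q \<in> omega_ideal" "q * p \<in> omega_ideal"
    by (auto intro: omega_ideal_mult_left omega_ideal_mult_right)
  then show ?case unfolding bracket_def omega_ideal_def by (rule pm.span_diff)
qed (auto simp: omega_ideal_def intro: pm.span_add pm.span_scale)

quotient_type (overloaded) ('g, 'k) lie_omega = "('g::finite, 'k::field) tens" /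
  partial: "\<lambda>p q. p \<in> free_lie \<and> q \<in> free_lie \<and> p - q \<in> lie_ideal"
  morphisms rep_lie_omega to_lie_omega
proof (rule part_equivpI)
  let ?R = "\<lambda>p q :: ('g, 'k) tens. p \<in> free_lie \<and> q \<in> free_lie \<and> p - q \<in> lie_ideal"
  show "\<exists>p. ?R p p" using zero_in_free_lie zero_in_lie_ideal by auto
  show "symp ?R" using lie_ideal_minus by (force intro!: sympI)
  show "transp ?R" by (rule transpI) (use lie_ideal.add in fastforce)
qed

definition lie_omega_deg :: "nat \<Rightarrow> ('g::finite, 'k::field) lie_omega set" where
  "lie_omega_deg d = to_lie_omega ` (free_lie \<inter> tens_deg d)"

text \<open>The canonical map from \<open>L(H)\<^sub>\<omega>\<close> to its enveloping algebra \<open>T(H)\<^sub>\<omega>\<close>; it does not depend on the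
  representative, as the lemma below shows.\<close>

definition lie_to_tens_omega :: "('g::finite, 'k::field) lie_omega \<Rightarrow> ('g, 'k) tens_omega" where
  "lie_to_tens_omega a = to_omega (rep_lie_omega a)"

lemma lie_to_tens_omega:
  assumes "p \<in> free_lie" shows "lie_to_tens_omega (to_lie_omega p) = to_omega p"
proof -
  have "rep_lie_omega (to_lie_omega p) - p \<in> lie_ideal"
    using rep_abs_rsp_left[OF Quotient3_lie_omega, of p p] assms by (simp add: zero_in_lie_ideal)
  then show ?thesis
    by (simp add: lie_to_tens_omega_def to_omega_eq_iff lie_ideal_le_omega_ideal)
qed

section \<open>The third exterior power\<close>

text \<open>The degree three part of the exterior algebra, that is, of the quotient of \<open>T(H)\<close> by the ideal
  generated by all \<open>v \<otimes> v\<close> with \<open>v\<close> in \<open>H\<close>.\<close>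

definition alt_relations :: "('g, 'k::field) tens set" where
  "alt_relations = pm.span {u * v * w | u v w. u \<in> HH \<and> v \<in> HH \<and> w \<in> HH \<and> (u = v \<or> v = w)}"

lemma subspace_tens_deg: "pm.subspace (tens_deg d)"
  by (rule pm.subspaceI) (auto simp: tens_deg_def in_keys_iff lookup_add)

quotient_type (overloaded) ('g, 'k) wedge3 = "('g, 'k::field) tens" /
  partial: "\<lambda>p q. p \<in> tens_deg 3 \<and> q \<in> tens_deg 3 \<and> p - q \<in> alt_relations"
  morphisms rep_wedge3 abs_wedge3
proof (rule part_equivpI)
  let ?R = "\<lambda>p q :: ('g, 'k) tens. p \<in> tens_deg 3 \<and> q \<in> tens_deg 3 \<and> p - q \<in> alt_relations"
  show "\<exists>p. ?R p p"
    using pm.subspace_0[OF subspace_tens_deg] by (auto simp: alt_relations_def pm.span_zero)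
  show "symp ?R" using pm.span_neg unfolding alt_relations_def by (force intro!: sympI)
  show "transp ?R" unfolding alt_relations_def by (rule transpI) (use pm.span_add in fastforce)
qed

instantiation wedge3 :: (type, field) ab_group_add
begin
lift_definition zero_wedge3 :: "('a, 'b) wedge3" is 0
  by (simp add: pm.subspace_0[OF subspace_tens_deg] alt_relations_def pm.span_zero)
lift_definition plus_wedge3 :: "('a, 'b) wedge3 \<Rightarrow> ('a, 'b) wedge3 \<Rightarrow> ('a, 'b) wedge3" is "(+)"
  unfolding alt_relations_def
  by (auto intro: pm.subspace_add[OF subspace_tens_deg] span_quotient_arith)
lift_definition minus_wedge3 :: "('a, 'b) wedge3 \<Rightarrow> ('a, 'b) wedge3 \<Rightarrow> ('a, 'b) wedge3" is "(-)"
  unfolding alt_relations_def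
  by (auto intro: pm.subspace_diff[OF subspace_tens_deg] span_quotient_arith)
lift_definition uminus_wedge3 :: "('a, 'b) wedge3 \<Rightarrow> ('a, 'b) wedge3" is uminus
  unfolding alt_relations_def
  by (elim conjE, intro conjI pm.subspace_neg[OF subspace_tens_deg] span_quotient_arith(3))
instance
proof
  fix a b c :: "('a, 'b) wedge3"
  show "a + b + c = a + (b + c)"
    by transfer (auto simp: add.assoc alt_relations_def pm.span_zero intro!: pm.subspace_add[OF subspace_tens_deg])
  show "a + b = b + a"
    by transfer (auto simp: add.commute alt_relations_def pm.span_zero intro!: pm.subspace_add[OF subspace_tens_deg])
  show "0 + a = a" by transfer simp
  show "- a + a = 0"
    by transfer (auto simp: alt_relations_def pm.span_zero intro!: pm.subspace_0[OF subspace_tens_deg])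
  show "a - b = a + - b"
    by transfer (auto simp: alt_relations_def pm.span_zero intro!: pm.subspace_diff[OF subspace_tens_deg])
qed
end

lift_definition scale_wedge3 :: "'k \<Rightarrow> ('g, 'k::field) wedge3 \<Rightarrow> ('g, 'k) wedge3" is pm_scale
  unfolding alt_relations_def
  by (elim conjE, intro conjI pm.subspace_scale[OF subspace_tens_deg] span_quotient_arith(4))

global_interpretation wedge3: vector_space scale_wedge3
proof
  fix a b :: "'k::field" and x y :: "('g, 'k) wedge3"
  show "scale_wedge3 a (x + y) = scale_wedge3 a x + scale_wedge3 a y"
    by transfer (auto simp: alt_relations_def pm.span_zero pm.scale_right_distrib
        intro!: pm.subspace_add[OF subspace_tens_deg] pm.subspace_scale[OF subspace_tens_deg])
  show "scale_wedge3 (a + b) x = scale_wedge3 a x + scale_wedge3 b x"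
    by transfer (auto simp: alt_relations_def pm.span_zero pm.scale_left_distrib
        intro!: pm.subspace_add[OF subspace_tens_deg] pm.subspace_scale[OF subspace_tens_deg])
  show "scale_wedge3 a (scale_wedge3 b x) = scale_wedge3 (a * b) x"
    by transfer (auto simp: alt_relations_def pm.span_zero intro!: pm.subspace_scale[OF subspace_tens_deg])
  show "scale_wedge3 1 x = x" by transfer simp
qed

text \<open>For \<open>u, v, w\<close> in \<open>H\<close>, this is \<open>u \<and> v \<and> w\<close>.\<close>

definition wedge :: "('g, 'k::field) tens \<Rightarrow> ('g, 'k) tens \<Rightarrow> ('g, 'k) tens \<Rightarrow> ('g, 'k) wedge3" where
  "wedge u v w = abs_wedge3 (u * v * w)"

text \<open>The identification of the third exterior power with a subspace of \<open>|T(H)|\<close>, which maps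
  \<open>u \<and> v \<and> w\<close> to \<open>|u [v, w]|\<close> (lemma \<open>wedge_to_trace\<close> below).\<close>

definition twist :: "('g, 'k::field) tens \<Rightarrow> ('g, 'k) tens" where
  "twist = lin_ext pm_scale (\<lambda>z. case letters z of
    [a, b, c] \<Rightarrow> var a * bracket (var b) (var c) | _ \<Rightarrow> 0)"

definition wedge_to_trace :: "('g, 'k::field) wedge3 \<Rightarrow> ('g, 'k) tens trace" where
  "wedge_to_trace \<eta> = tr (twist (rep_wedge3 \<eta>))"

interpretation twist: Vector_Spaces.linear pm_scale pm_scale twist
  unfolding twist_def by (rule linear_lin_ext) (rule pm.vector_space_axioms)

lemma twist_mult:
  assumes "u \<in> HH" "v \<in> HH" "w \<in> HH"
  shows "twist (u * v * w) = u * bracket v w"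
proof -
  have 1: "twist (var a * var b * var c) = var a * bracket (var b) (var c)" for a b c
    by (simp add: twist_def var_def mult_single lin_ext_single[OF pm.vector_space_axioms] plus_word_def)
  have 2: "twist (var a * var b * w) = var a * bracket (var b) w" if "w \<in> HH" for a b w
    using that unfolding HH_def
    by (induction rule: pm.span_induct_alt)
      (auto simp: distrib_left distrib_right twist.add twist.scale pm_scale_mult_left
        pm_scale_mult_right 1 bracket_def pm.scale_right_diff_distrib right_diff_distrib)
  have 3: "twist (var a * v * w) = var a * bracket v w" if "v \<in> HH" "w \<in> HH" for a v w
    using that(1) unfolding HH_def
    by (induction rule: pm.span_induct_alt)
      (auto simp: distrib_left distrib_right twist.add twist.scale pm_scale_mult_left
        pm_scale_mult_right 2[OF that(2)] bracket_def pm.scale_right_diff_distrib right_diff_distrib)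
  show ?thesis
    using assms(1) unfolding HH_def
    by (induction rule: pm.span_induct_alt)
      (auto simp: distrib_right twist.add twist.scale pm_scale_mult_left 3[OF assms(2,3)])
qed

lemma linear_tr: "Vector_Spaces.linear pm_scale scale_trace tr"
  by (rule linearI_pm) (simp_all add: trace.vector_space_axioms plus_trace.abs_eq scale_trace.abs_eq)

lemma tr_twist_alt_relations: "p \<in> alt_relations \<Longrightarrow> tr (twist p) = 0"
  unfolding alt_relations_def
proof (induction rule: pm.span_induct_alt)
  case base
  show ?case by (simp add: zero_trace_def)
next
  case (step c x y)
  interpret tr: Vector_Spaces.linear pm_scale scale_trace tr by (rule linear_tr)
  from step(1) obtain u v w where x: "x = u * v * w" and H: "u \<in> HH" "v \<in> HH" "w \<in> HH"
    and "u = v \<or> v = w" by auto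
  from this(5) have "tr (u * bracket v w) = 0"
    by (auto simp: bracket_def right_diff_distrib tr.diff tr.zero)
       (metis cancel_comm_monoid_add_class.diff_cancel mult.assoc tr_mult_commute)
  with step(2) show ?case
    by (simp add: x twist.add twist.scale tr.add tr.scale twist_mult[OF H])
qed

lemma wedge_to_trace_abs:
  assumes "p \<in> tens_deg 3" shows "wedge_to_trace (abs_wedge3 p) = tr (twist p)"
proof -
  interpret tr: Vector_Spaces.linear pm_scale scale_trace tr by (rule linear_tr)
  have "rep_wedge3 (abs_wedge3 p) - p \<in> alt_relations"
    using rep_abs_rsp_left[OF Quotient3_wedge3, of p p] assms
    by (simp add: alt_relations_def pm.span_zero)
  from tr_twist_alt_relations[OF this] show ?thesis
    by (simp add: wedge_to_trace_def twist.diff tr.diff)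
qed

lemma mult_in_tens_deg: "p \<in> tens_deg m \<Longrightarrow> q \<in> tens_deg n \<Longrightarrow> p * q \<in> tens_deg (m + n)"
  using keys_mult[of p q] by (fastforce simp: tens_deg_def plus_word_def)

lemma HH_le_tens_deg: "HH \<subseteq> tens_deg 1"
  unfolding HH_def by (rule pm.span_minimal[OF _ subspace_tens_deg]) (auto simp: var_def tens_deg_def)

lemma wedge_to_trace:
  assumes "u \<in> HH" "v \<in> HH" "w \<in> HH"
  shows "wedge_to_trace (wedge u v w) = tr (u * bracket v w)"
proof -
  have "u * v * w \<in> tens_deg (1 + 1 + 1)"
    using assms HH_le_tens_deg by (blast intro: mult_in_tens_deg)
  then have "u * v * w \<in> tens_deg 3" by (simp add: eval_nat_numeral)
  then show ?thesis by (simp add: wedge_def wedge_to_trace_abs twist_mult assms)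
qed

lemma linear_wedge_to_trace: "Vector_Spaces.linear scale_wedge3 scale_trace wedge_to_trace"
proof -
  interpret tr: Vector_Spaces.linear pm_scale scale_trace tr by (rule linear_tr)
  have ex: "\<exists>p \<in> tens_deg 3. \<eta> = abs_wedge3 p" for \<eta> :: "('b, 'a) wedge3"
    by (induction \<eta> rule: wedge3.abs_induct) auto
  have "wedge_to_trace (\<eta> + \<theta>) = wedge_to_trace \<eta> + wedge_to_trace \<theta>"
    "wedge_to_trace (scale_wedge3 c \<eta>) = scale_trace c (wedge_to_trace \<eta>)" for \<eta> \<theta> :: "('b, 'a) wedge3" and c
  proof -
    from ex obtain p q where *: "p \<in> tens_deg 3" "\<eta> = abs_wedge3 p" "q \<in> tens_deg 3" "\<theta> = abs_wedge3 q"
      by metis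
    have z: "(0 :: ('b, 'a) tens) \<in> alt_relations" by (simp add: alt_relations_def pm.span_zero)
    show "wedge_to_trace (\<eta> + \<theta>) = wedge_to_trace \<eta> + wedge_to_trace \<theta>"
      using * z by (simp add: plus_wedge3.abs_eq wedge_to_trace_abs twist.add tr.add
          pm.subspace_add[OF subspace_tens_deg])
    show "wedge_to_trace (scale_wedge3 c \<eta>) = scale_trace c (wedge_to_trace \<eta>)"
      using * z by (simp add: scale_wedge3.abs_eq wedge_to_trace_abs twist.scale tr.scale
          pm.subspace_scale[OF subspace_tens_deg])
  qed
  then show ?thesis
    unfolding linear_iff_module_hom module_hom_iff
    by (simp add: module_iff_vector_space wedge3.vector_space_axioms trace.vector_space_axioms)
qed

text \<open>The subspace \<open>|H \<omega>|\<close> of the third exterior power, the latter being regarded as a subspace of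
  \<open>|T(H)|\<close>.\<close>

definition H_omega :: "('g::finite, 'k::field) wedge3 set" where
  "H_omega = {\<eta>. wedge_to_trace \<eta> \<in> trace_prod pm_scale HH (range (\<lambda>c. pm_scale c omega))}"

lemma subspace_H_omega: "wedge3.subspace H_omega"
proof -
  interpret L: Vector_Spaces.linear scale_wedge3 scale_trace wedge_to_trace by (rule linear_wedge_to_trace)
  interpret tr: Vector_Spaces.linear pm_scale scale_trace tr by (rule linear_tr)
  have "trace.subspace (trace_prod pm_scale HH (range (\<lambda>c. pm_scale c omega)))"
    unfolding trace_prod_def by (rule tr.subspace_image) (rule pm.subspace_span)
  from L.subspace_vimage[OF this] show ?thesis by (simp add: H_omega_def vimage_def)
qed

quotient_type (overloaded) ('g, 'k) wedge3_mod_omega = "('g::finite, 'k::field) wedge3" /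
  "\<lambda>\<eta> \<theta>. \<eta> - \<theta> \<in> H_omega"
  morphisms rep_wedge3_mod to_wedge3_mod
proof (rule equivpI)
  let ?R = "\<lambda>\<eta> \<theta> :: ('g, 'k) wedge3. \<eta> - \<theta> \<in> H_omega"
  show "reflp ?R" using wedge3.subspace_0[OF subspace_H_omega] by (auto intro!: reflpI)
  show "symp ?R" using wedge3.subspace_neg[OF subspace_H_omega] by (force intro!: sympI)
  show "transp ?R" by (rule transpI) (drule (1) wedge3.subspace_add[OF subspace_H_omega], simp)
qed

instantiation wedge3_mod_omega :: (finite, field) ab_group_add
begin
lift_definition zero_wedge3_mod_omega :: "('a, 'b) wedge3_mod_omega" is 0 .
lift_definition plus_wedge3_mod_omega ::
  "('a, 'b) wedge3_mod_omega \<Rightarrow> ('a, 'b) wedge3_mod_omega \<Rightarrow> ('a, 'b) wedge3_mod_omega" is "(+)"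
  by (drule (1) wedge3.subspace_add[OF subspace_H_omega]) (simp add: algebra_simps)
lift_definition minus_wedge3_mod_omega ::
  "('a, 'b) wedge3_mod_omega \<Rightarrow> ('a, 'b) wedge3_mod_omega \<Rightarrow> ('a, 'b) wedge3_mod_omega" is "(-)"
  by (drule (1) wedge3.subspace_diff[OF subspace_H_omega]) (simp add: algebra_simps)
lift_definition uminus_wedge3_mod_omega :: "('a, 'b) wedge3_mod_omega \<Rightarrow> ('a, 'b) wedge3_mod_omega"
  is uminus
  by (drule wedge3.subspace_neg[OF subspace_H_omega]) simp
instance
  by standard (transfer; simp add: wedge3.subspace_0[OF subspace_H_omega] algebra_simps)+
end

lift_definition scale_wedge3_mod ::
  "'k \<Rightarrow> ('g::finite, 'k::field) wedge3_mod_omega \<Rightarrow> ('g, 'k) wedge3_mod_omega" is scale_wedge3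
  by (drule wedge3.subspace_scale[OF subspace_H_omega]) (simp add: wedge3.scale_right_diff_distrib)

global_interpretation wedge3_mod: vector_space scale_wedge3_mod
  by standard (transfer; simp add: wedge3.subspace_0[OF subspace_H_omega]
    wedge3.scale_right_distrib wedge3.scale_left_distrib)+

end

theory Submission
  imports Defs
begin

text \<open>Contracting the first tensor factor of \<open>|\<Delta>|\<close> with the functional dual to a letter \<open>e\<close> yields
  the derivation \<open>\<partial>\<^sub>e\<close> that deletes one occurrence of \<open>e\<close>. Hence if \<open>|p|\<close> is in the kernel, every
  \<open>|\<partial>\<^sub>e p|\<close> vanishes in \<open>|T(H)\<^sub>\<omega>|\<close>. In degrees 2, 3 and 4 a combination of the reinsertions of \<open>e\<close> into
  the cyclic words of \<open>\<partial>\<^sub>e p\<close>, summed over \<open>e\<close>, gives back a nonzero multiple of \<open>|p|\<close> modulo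
  \<open>|H L(H)|\<close>. In degrees 2 and 3, \<open>|\<partial>\<^sub>e p|\<close> already vanishes in \<open>|T(H)|\<close>, so the kernel lies in \<open>|H L(H)|\<close>. In
  degree 4, however, \<open>|\<partial>\<^sub>e p| = |h\<^sub>e \<omega>|\<close> in \<open>|T(H)|\<close> for some \<open>h\<^sub>e\<close> in \<open>H\<close>. The alternating part of
  \<open>\<Sum>\<^sub>e e \<partial>\<^sub>e p\<close> is zero, so \<open>\<Sum>\<^sub>e e \<and> h\<^sub>e \<and> \<omega> = 0\<close>; for \<open>g \<ge> 3\<close> this makes \<open>\<Sum>\<^sub>e e \<otimes> h\<^sub>e\<close> symmetric,
  and symmetric tensors contribute nothing to the reinsertion in \<open>|T(H)\<^sub>\<omega>|\<close>. For \<open>g = 1\<close> all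
  \<open>|h\<^sub>e \<omega>|\<close> vanish. The converse inclusion holds because Lie elements are primitive.\<close>

section \<open>Linear maps tested on words, and the span of the commutators\<close>

instance symp :: (finite) finite
proof
  have "a \<in> range X \<union> range Y" for a :: "'a symp" by (cases a) auto
  then show "finite (UNIV :: 'a symp set)"
    by (intro finite_subset[of UNIV "range X \<union> range Y"]) auto
qed

abbreviation monom :: "'g symp list \<Rightarrow> ('g, 'k::field) tens" where
  "monom xs \<equiv> Poly_Mapping.single (Word xs) 1"

text \<open>A homogeneous tensor is a linear combination of words of its degree, so identities in
  low degree need only be checked on words with two, three or four letters.\<close>

lemma linear_mem_of_monom:
  assumes f: "Vector_Spaces.linear pm_scale s f" and Z: "module.subspace s Z"
    and monom: "\<And>xs. length xs = d \<Longrightarrow> f (monom xs) \<in> Z" and p: "p \<in> tens_deg d"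
  shows "f p \<in> Z"
proof -
  interpret f: Vector_Spaces.linear pm_scale s f by fact
  have "f p = (\<Sum>w\<in>Poly_Mapping.keys p. s (Poly_Mapping.lookup p w) (f (Poly_Mapping.single w 1)))"
    by (subst pm_expand[of p]) (simp only: f.sum f.scale)
  also have "\<dots> \<in> Z"
  proof (intro f.vs2.subspace_sum[OF Z] f.vs2.subspace_scale[OF Z])
    fix w assume "w \<in> Poly_Mapping.keys p"
    then have "length (letters w) = d" using p by (auto simp: tens_deg_def)
    from monom[OF this] show "f (Poly_Mapping.single w 1) \<in> Z" by simp
  qed
  finally show ?thesis .
qed

lemma linear_eq_of_monom:
  assumes f: "Vector_Spaces.linear pm_scale s f" and g: "Vector_Spaces.linear pm_scale s g"
    and monom: "\<And>xs. length xs = d \<Longrightarrow> f (monom xs) = g (monom xs)" and p: "p \<in> tens_deg d"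
  shows "f p = g p"
proof -
  interpret f: Vector_Spaces.linear pm_scale s f by fact
  interpret g: Vector_Spaces.linear pm_scale s g by fact
  have "f p - g p \<in> {0}"
  proof (rule linear_mem_of_monom[of s "\<lambda>p. f p - g p" "{0}" d])
    show "Vector_Spaces.linear pm_scale s (\<lambda>p. f p - g p)"
      by (rule linearI_pm)
        (auto simp: f.add g.add f.scale g.scale f.vs2.scale_right_diff_distrib f.vs2.vector_space_axioms)
  qed (auto simp: monom p)
  then show ?thesis by simp
qed

lemma subspace_comm_span: "pm.subspace (comm_span :: ('b::monoid_add \<Rightarrow>\<^sub>0 'k::field) set)"
  by (rule pm.subspaceI)
    (auto intro: comm_span.zero comm_span_add comm_span_scale
      simp: pm.scale_right_distrib pm_scale_mult_left pm_scale_mult_right)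

lemma monom_in_tens_deg: "monom xs \<in> tens_deg (length xs)"
  by (simp add: tens_deg_def)

lemma tens_deg_1: "tens_deg 1 = HH"
proof
  show "tens_deg 1 \<subseteq> (HH :: ('a, 'b) tens set)"
  proof
    fix p :: "('a, 'b) tens" assume "p \<in> tens_deg 1"
    then show "p \<in> HH"
      by (rule linear_mem_of_monom[OF pm.linear_ident, rotated 2])
        (auto simp: HH_def var_def length_Suc_conv intro: pm.span_base)
  qed
qed (rule HH_le_tens_deg)

text \<open>Words span \<open>T(H)\<close>, so by bilinearity it suffices to treat the commutator of
  two words \<open>xs\<close> and \<open>ys\<close>, which is the difference of
  \<open>xs @ ys\<close> and its rotation \<open>ys @ xs\<close>. In this way a rotation-invariant
  functional on words descends to \<open>|T(H)|\<close>.\<close>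

lemma linear_vanishes_on_comm_span:
  assumes "Vector_Spaces.linear pm_scale s (f :: ('g, 'k::field) tens \<Rightarrow> _)"
    and rot: "\<And>xs ys. f (monom (xs @ ys)) = f (monom (ys @ xs))"
    and "p \<in> comm_span"
  shows "f p = 0"
proof -
  interpret f: Vector_Spaces.linear pm_scale s f by fact
  have "f (p * q) = f (q * p)" for p q
  proof (rule bilinear_from_pm_eq[of s "\<lambda>p q. f (p * q)" "\<lambda>p q. f (q * p)"])
    fix u v :: "'g symp word"
    show "f (Poly_Mapping.single u 1 * Poly_Mapping.single v 1) =
        f (Poly_Mapping.single v 1 * Poly_Mapping.single u 1)"
      by (simp add: mult_single plus_word_def rot)
  qed (auto intro!: linearI_pm f.vs2.vector_space_axioms simp: distrib_left distrib_right f.add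
      f.scale pm_scale_mult_left pm_scale_mult_right)
  with assms(3) show ?thesis
    by (induction rule: comm_span.induct) (simp_all add: bracket_def f.add f.diff)
qed

lemma omega_monom: "omega = (\<Sum>i\<in>UNIV. monom [X i, Y i] - monom [Y i, X i])"
  by (simp add: omega_def bracket_def var_def mult_single plus_word_def)

lemma omega_in_comm_span: "omega \<in> comm_span"
  unfolding omega_def by (intro pm.subspace_sum[OF subspace_comm_span] comm_span_bracket)

lemma omega_in_tens_deg: "omega \<in> tens_deg 2"
proof -
  have "monom [a, b] \<in> tens_deg 2" for a b :: "'a symp"
    using monom_in_tens_deg[of "[a, b]"] by (simp add: numeral_2_eq_2)
  then show ?thesis
    unfolding omega_monom by (intro pm.subspace_sum pm.subspace_diff subspace_tens_deg)
qed

section \<open>The kernel of the projection to the trace space\<close>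

abbreviation trace_class :: "('g::finite, 'k::field) tens \<Rightarrow> ('g, 'k) tens_omega trace" where
  "trace_class p \<equiv> tr (to_omega p)"

lemma linear_tr_omega: "Vector_Spaces.linear scale_omega scale_trace_omega tr"
  unfolding linear_iff_module_hom module_hom_iff
  by (simp add: module_iff_vector_space omega.vector_space_axioms trace_omega.vector_space_axioms
      plus_trace.abs_eq scale_trace_omega.abs_eq)

interpretation tr_omega: Vector_Spaces.linear scale_omega scale_trace_omega tr
  by (rule linear_tr_omega)

lemma linear_trace_class: "Vector_Spaces.linear pm_scale scale_trace_omega trace_class"
  by (rule linearI_pm)
    (simp_all add: trace_omega.vector_space_axioms to_omega.add to_omega.scale tr_omega.add tr_omega.scale)

interpretation trace_class: Vector_Spaces.linear pm_scale scale_trace_omega trace_class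
  by (rule linear_trace_class)

lemma to_omega_mult: "to_omega (p * q) = to_omega p * to_omega q"
  by (simp add: times_tens_omega.abs_eq)

lemma trace_class_comm_span: "p \<in> comm_span \<Longrightarrow> trace_class p = 0"
proof (rule linear_vanishes_on_comm_span[OF linear_trace_class])
  fix xs ys :: "'a symp list"
  show "trace_class (monom (xs @ ys) :: ('a, 'b) tens) = trace_class (monom (ys @ xs))"
    using tr_mult_commute[of "to_omega (monom xs)" "to_omega (monom ys)"]
    by (simp add: mult_single plus_word_def flip: to_omega_mult)
qed

lemma trace_class_omega_ideal: "p \<in> omega_ideal \<Longrightarrow> trace_class p = 0"
  by (simp add: to_omega_ideal tr_omega.zero)

text \<open>A commutator in the quotient algebra lifts to a commutator in \<open>T(H)\<close>. Hence
  the kernel of the projection from \<open>T(H)\<close> to \<open>|T(H)\<^sub>\<omega>|\<close> is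
  the sum of the commutator span and the ideal of \<open>omega\<close>.\<close>

lemma trace_class_eq_0_iff:
  "trace_class p = 0 \<longleftrightarrow> (\<exists>c \<in> comm_span. p - c \<in> omega_ideal)"
proof
  assume "trace_class p = 0"
  then have "to_omega p \<in> comm_span"
    using tr_eq_iff[of "to_omega p" 0] by (simp add: tr_omega.zero)
  moreover have "\<exists>c \<in> comm_span. a = to_omega c" if "a \<in> comm_span" for a :: "('a, 'b) tens_omega"
    using that
  proof induction
    case zero
    show ?case using comm_span.zero to_omega.zero by metis
  next
    case (add x a b)
    obtain p q where "a = to_omega p" "b = to_omega q"
      by (metis Quotient3_abs_rep[OF Quotient3_tens_omega])
    then have "bracket a b = to_omega (bracket p q)"
      by (simp add: bracket_def to_omega.diff to_omega_mult)
    with add(2) show ?case by (metis comm_span.add to_omega.add)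
  qed
  ultimately show "\<exists>c \<in> comm_span. p - c \<in> omega_ideal" by (metis to_omega_eq_iff)
next
  assume "\<exists>c \<in> comm_span. p - c \<in> omega_ideal"
  then obtain c where "c \<in> comm_span" "p - c \<in> omega_ideal" by auto
  then show "trace_class p = 0"
    using trace_class_comm_span[of c] trace_class_omega_ideal[of "p - c"] trace_class.diff[of p c]
    by simp
qed

section \<open>Homogeneous components of the kernel of the projection\<close>

definition proj :: "nat \<Rightarrow> ('g, 'k::field) tens \<Rightarrow> ('g, 'k) tens" where
  "proj d = lin_ext pm_scale (\<lambda>w. if length (letters w) = d then Poly_Mapping.single w 1 else 0)"

interpretation proj: Vector_Spaces.linear pm_scale pm_scale "proj d"
  unfolding proj_def by (rule linear_lin_ext) (rule pm.vector_space_axioms)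

lemma proj_single:
  "proj d (Poly_Mapping.single w 1) = (if length (letters w) = d then Poly_Mapping.single w 1 else 0)"
  by (simp add: proj_def lin_ext_single[OF pm.vector_space_axioms])

lemma proj_tens_deg: "p \<in> tens_deg e \<Longrightarrow> proj d p = (if e = d then p else 0)"
proof (rule linear_eq_of_monom[of pm_scale "proj d" "\<lambda>p. if e = d then p else 0" e])
  show "Vector_Spaces.linear pm_scale pm_scale (\<lambda>p. if e = d then p else 0)"
    by (rule linearI_pm) (simp_all add: pm.vector_space_axioms)
qed (simp_all add: proj_single proj.linear_axioms)

text \<open>Rotating a word preserves its length, so \<open>tr\<close> composed with a degree
  projection is still rotation-invariant on words. The commutator span is therefore graded.\<close>

lemma comm_span_proj: "p \<in> comm_span \<Longrightarrow> proj d p \<in> comm_span"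
proof -
  interpret tr: Vector_Spaces.linear pm_scale scale_trace tr by (rule linear_tr)
  assume "p \<in> comm_span"
  then have "tr (proj d p) = 0"
  proof (rule linear_vanishes_on_comm_span[rotated 2])
    show "Vector_Spaces.linear pm_scale scale_trace (\<lambda>p. tr (proj d p))"
      by (rule linearI_pm) (simp_all add: tr.add tr.scale proj.add proj.scale trace.vector_space_axioms)
    fix xs ys :: "'a symp list"
    have "tr (monom (xs @ ys) :: ('a, 'b) tens) = tr (monom (ys @ xs))"
      using tr_mult_commute[of "monom xs" "monom ys"] by (simp add: mult_single plus_word_def)
    then show "tr (proj d (monom (xs @ ys)) :: ('a, 'b) tens) = tr (proj d (monom (ys @ xs)))"
      by (cases "length xs + length ys = d") (auto simp: proj_single)
  qed
  then show ?thesis using tr_eq_iff[of "proj d p" 0] by (simp add: tr.zero)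
qed

text \<open>The expression \<open>a * omega * b\<close> is linear in \<open>a\<close> and in
  \<open>b\<close>, so the ideal is spanned by the products with words on both sides.\<close>

lemma omega_ideal_minimal:
  fixes Z :: "('g::finite, 'k::field) tens set"
  assumes Z: "pm.subspace Z" and monom: "\<And>xs ys. monom xs * omega * monom ys \<in> Z"
  shows "omega_ideal \<subseteq> Z"
proof -
  have single: "p \<in> pm.span (range monom)" for p :: "('g, 'k) tens"
    by (subst pm_expand[of p], intro pm.span_sum pm.span_scale pm.span_base)
      (metis rangeI word.collapse)
  have left: "a * omega * monom ys \<in> Z" for a ys
    using single[of a]
    by (induction rule: pm.span_induct_alt)
      (auto simp: distrib_right pm_scale_mult_left monom
        intro!: pm.subspace_0[OF Z] pm.subspace_add[OF Z] pm.subspace_scale[OF Z])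
  have "a * omega * b \<in> Z" for a b
    using single[of b]
    by (induction rule: pm.span_induct_alt)
      (auto simp: distrib_left pm_scale_mult_right left
        intro!: pm.subspace_0[OF Z] pm.subspace_add[OF Z] pm.subspace_scale[OF Z])
  then show ?thesis
    unfolding omega_ideal_def by (intro pm.span_minimal[OF _ Z]) auto
qed

text \<open>Under the trace, \<open>u \<omega> v\<close> may be rotated to
  \<open>v u \<omega>\<close>, so only multiples of \<open>omega\<close> from the left survive. This
  determines the kernel of \<open>|T(H)| \<rightarrow> |T(H)\<^sub>\<omega>|\<close> in each degree
  that is at least two.\<close>

lemma tens_deg_mult_omega:
  assumes "trace_class q = 0" "q \<in> tens_deg (k + 2)"
  shows "\<exists>r \<in> tens_deg k. q - r * omega \<in> comm_span"
proof -
  \<comment> \<open>An element of the ideal need not be homogeneous, so the claim is stated for its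
    component of degree \<open>k + 2\<close>. Written this way, it defines a subspace.\<close>
  define Z where "Z = {p :: ('a, 'b) tens. \<exists>r \<in> tens_deg k. proj (k + 2) p - r * omega \<in> comm_span}"
  have Z: "pm.subspace Z"
  proof (rule pm.subspaceI)
    show "0 \<in> Z"
      using pm.subspace_0[OF subspace_tens_deg[of k]] comm_span.zero
      by (force simp: Z_def proj.zero)
  next
    fix x y assume "x \<in> Z" "y \<in> Z"
    then obtain r s where *: "r \<in> tens_deg k" "s \<in> tens_deg k"
      "proj (k + 2) x - r * omega \<in> comm_span" "proj (k + 2) y - s * omega \<in> comm_span"
      by (auto simp: Z_def)
    have "proj (k + 2) (x + y) - (r + s) * omega \<in> comm_span"
      using comm_span_add[OF *(3,4)] by (simp add: proj.add algebra_simps)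
    then show "x + y \<in> Z" using pm.subspace_add[OF subspace_tens_deg *(1,2)] by (auto simp: Z_def)
  next
    fix c x assume "x \<in> Z"
    then obtain r where *: "r \<in> tens_deg k" "proj (k + 2) x - r * omega \<in> comm_span"
      by (auto simp: Z_def)
    have "proj (k + 2) (pm_scale c x) - pm_scale c r * omega \<in> comm_span"
      using pm.subspace_scale[OF subspace_comm_span *(2), of c]
      by (simp add: proj.scale pm_scale_mult_left pm.scale_right_diff_distrib)
    then show "pm_scale c x \<in> Z" using pm.subspace_scale[OF subspace_tens_deg *(1)] by (auto simp: Z_def)
  qed
  have monom: "monom xs * omega * monom ys \<in> Z" for xs ys
  proof -
    have "monom xs * omega * monom ys \<in> (tens_deg (length xs + 2 + length ys) :: ('a, 'b) tens set)"
      by (intro mult_in_tens_deg monom_in_tens_deg omega_in_tens_deg)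
    note * = proj_tens_deg[OF this, of "k + 2"]
    show ?thesis
    proof (cases "length xs + length ys = k")
      case True
      have "monom ys * monom xs \<in> (tens_deg k :: ('a, 'b) tens set)"
        using mult_in_tens_deg[OF monom_in_tens_deg[of ys] monom_in_tens_deg[of xs]] True
        by (simp add: add.commute)
      \<comment> \<open>This is the commutator of \<open>monom xs * omega\<close> and
        \<open>monom ys\<close>, which rotates \<open>ys\<close> to the front.\<close>
      moreover have "monom xs * omega * monom ys - monom ys * monom xs * omega \<in> comm_span"
        using comm_span_bracket[of "monom xs * omega" "monom ys"] by (simp add: bracket_def mult.assoc)
      ultimately show ?thesis using * True by (auto simp: Z_def)
    next
      case False
      then show ?thesis
        using * pm.subspace_0[OF subspace_tens_deg[of k]] comm_span.zero by (force simp: Z_def)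
    qed
  qed
  have "omega_ideal \<subseteq> Z" by (rule omega_ideal_minimal[OF Z monom])
  moreover obtain c where c: "c \<in> comm_span" "q - c \<in> omega_ideal"
    using assms(1) by (auto simp: trace_class_eq_0_iff)
  ultimately obtain r where r: "r \<in> tens_deg k" "proj (k + 2) (q - c) - r * omega \<in> comm_span"
    by (auto simp: Z_def)
  have "q - r * omega = (proj (k + 2) (q - c) - r * omega) + proj (k + 2) c"
    using proj_tens_deg[OF assms(2), of "k + 2"] by (simp add: proj.diff)
  with comm_span_add[OF r(2) comm_span_proj[OF c(1)]] r(1) show ?thesis by metis
qed

section \<open>Contracting the coproduct with a letter\<close>

lemma vector_space_times: "vector_space ((*) :: 'k::field \<Rightarrow> 'k \<Rightarrow> 'k)"
  by standard (auto simp: algebra_simps)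

lemma linear_lookup: "Vector_Spaces.linear pm_scale (*) (\<lambda>p. Poly_Mapping.lookup p w)"
  by (rule linearI_pm) (simp_all add: vector_space_times lookup_add)

text \<open>The functional dual to the letter \<open>e\<close>, read off from an arbitrary
  representative in \<open>T(H)\<close>. The next lemma shows that the choice does not
  matter.\<close>

definition letter_coeff :: "'g::finite symp \<Rightarrow> ('g, 'k::field) tens_omega trace \<Rightarrow> 'k" where
  "letter_coeff e t = Poly_Mapping.lookup (rep_omega (rep_trace t)) (Word [e])"

text \<open>Two representatives differ by commutators and elements of the ideal of
  \<open>omega\<close>. Neither kind has a component in degree one: splitting a one-letter word
  leaves an empty side, so its rotation is the same word, and \<open>omega\<close> starts in degree
  two.\<close>

lemma letter_coeff_trace_class:
  fixes p :: "('g::finite, 'k::field) tens"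
  shows "letter_coeff e (trace_class p) = Poly_Mapping.lookup p (Word [e])"
proof -
  let ?q = "rep_omega (rep_trace (trace_class p))"
  have "trace_class ?q = trace_class p"
    by (simp add: Quotient3_abs_rep[OF Quotient3_tens_omega] Quotient3_abs_rep[OF Quotient3_trace])
  then obtain c where c: "c \<in> comm_span" "?q - p - c \<in> omega_ideal"
    using trace_class_eq_0_iff[of "?q - p"] by (auto simp: trace_class.diff)
  have "Poly_Mapping.lookup c (Word [e]) = 0"
    by (rule linear_vanishes_on_comm_span[OF linear_lookup _ c(1)])
      (auto simp: lookup_single when_def append_eq_Cons_conv)
  moreover have "omega_ideal \<subseteq> {p :: ('g, 'k) tens. Poly_Mapping.lookup p (Word [e]) = 0}"
  proof (rule omega_ideal_minimal)
    show "pm.subspace {p :: ('g, 'k) tens. Poly_Mapping.lookup p (Word [e]) = 0}"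
      by (rule pm.subspaceI) (auto simp: lookup_add)
    fix xs ys
    have "monom xs * omega * monom ys \<in> (tens_deg (length xs + 2 + length ys) :: ('g, 'k) tens set)"
      by (intro mult_in_tens_deg monom_in_tens_deg omega_in_tens_deg)
    then show "monom xs * omega * monom ys \<in> {p :: ('g, 'k) tens. Poly_Mapping.lookup p (Word [e]) = 0}"
      by (force simp: tens_deg_def in_keys_iff)
  qed
  ultimately show ?thesis using c(2) by (auto simp: letter_coeff_def lookup_minus)
qed

lemma trace_class_surj: "\<exists>p. t = trace_class p"
  by (metis Quotient3_abs_rep[OF Quotient3_tens_omega] Quotient3_abs_rep[OF Quotient3_trace])

lemma letter_coeff_add: "letter_coeff e (s + t) = letter_coeff e s + letter_coeff e t"
proof -
  obtain p q where "s = trace_class p" "t = trace_class q" using trace_class_surj by metis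
  then show ?thesis by (simp add: letter_coeff_trace_class lookup_add flip: trace_class.add)
qed

lemma letter_coeff_scale: "letter_coeff e (scale_trace_omega c t) = c * letter_coeff e t"
proof -
  obtain p where "t = trace_class p" using trace_class_surj by metis
  then show ?thesis by (simp add: letter_coeff_trace_class flip: trace_class.scale)
qed

text \<open>The maps \<open>s \<otimes> t \<mapsto> e\<^sup>*(s) t\<close> detect everything needed of the tensor square, so that no
  basis of it is required.\<close>

definition contract :: "'g::finite symp \<Rightarrow> ('g, 'k::field) trace_omega_sq \<Rightarrow> ('g, 'k) tens_omega trace" where
  "contract e z = lin_ext scale_trace_omega (\<lambda>(s, t). scale_trace_omega (letter_coeff e s) t) (rep_trace_sq z)"

text \<open>The assignment \<open>(s, t) \<mapsto> e\<^sup>*(s) t\<close> is bilinear, so its linear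
  extension kills the relations of the tensor product.\<close>

lemma contract_abs:
  "contract e (abs_trace_sq p) = lin_ext scale_trace_omega (\<lambda>(s, t). scale_trace_omega (letter_coeff e s) t) p"
proof -
  let ?L = "lin_ext scale_trace_omega (\<lambda>(s, t). scale_trace_omega (letter_coeff e s) t) ::
    (('a, 'b) tens_omega trace \<times> ('a, 'b) tens_omega trace \<Rightarrow>\<^sub>0 'b) \<Rightarrow> _"
  interpret L: Vector_Spaces.linear pm_scale scale_trace_omega ?L
    by (rule linear_lin_ext) (rule trace_omega.vector_space_axioms)
  note [simp] = lin_ext_single[OF trace_omega.vector_space_axioms]
  have "?L q = 0" if "q \<in> tensor_relations scale_trace_omega scale_trace_omega" for q
    using that unfolding tensor_relations_def
  proof (induction rule: pm.span_induct_alt)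
    case (step c x y)
    from step(1) have "?L x = 0"
      by (auto simp: L.diff letter_coeff_add letter_coeff_scale trace_omega.scale_left_distrib
          trace_omega.scale_right_distrib mult.commute)
    with step(2) show ?case by (simp add: L.add L.scale)
  qed simp
  moreover have "abs_trace_sq (rep_trace_sq (abs_trace_sq p)) = abs_trace_sq p"
    by (rule Quotient3_abs_rep[OF Quotient3_trace_omega_sq])
  ultimately have "?L (rep_trace_sq (abs_trace_sq p) - p) = 0"
    by (simp add: trace_omega_sq.abs_eq_iff)
  then show ?thesis by (simp add: L.diff contract_def)
qed

lemma contract_tensor: "contract e (tensor_trace s t) = scale_trace_omega (letter_coeff e s) t"
  by (simp add: tensor_trace_def contract_abs lin_ext_single[OF trace_omega.vector_space_axioms])

lemma linear_contract: "Vector_Spaces.linear scale_trace_sq scale_trace_omega (contract e)"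
proof -
  interpret L: Vector_Spaces.linear pm_scale scale_trace_omega
    "lin_ext scale_trace_omega (\<lambda>(s, t). scale_trace_omega (letter_coeff e s) t) ::
      (('b, 'a) tens_omega trace \<times> ('b, 'a) tens_omega trace \<Rightarrow>\<^sub>0 'a) \<Rightarrow> _"
    by (rule linear_lin_ext) (rule trace_omega.vector_space_axioms)
  have "contract e (y + z) = contract e y + contract e z" for y z :: "('b, 'a) trace_omega_sq"
    by (induction y rule: trace_omega_sq.abs_induct, induction z rule: trace_omega_sq.abs_induct)
      (simp add: plus_trace_omega_sq.abs_eq contract_abs L.add)
  moreover have "contract e (scale_trace_sq c z) = scale_trace_omega c (contract e z)"
    for c and z :: "('b, 'a) trace_omega_sq"
    by (induction z rule: trace_omega_sq.abs_induct)
      (simp add: scale_trace_sq.abs_eq contract_abs L.scale)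
  ultimately show ?thesis
    unfolding linear_iff_module_hom module_hom_iff
    by (simp add: module_iff_vector_space trace_sq.vector_space_axioms trace_omega.vector_space_axioms)
qed

interpretation contract: Vector_Spaces.linear scale_trace_sq scale_trace_omega "contract e"
  by (rule linear_contract)

section \<open>Deletion of a letter as a contracted coproduct\<close>

definition left_coeff :: "'g symp word \<Rightarrow> ('g, 'k::field) tens_sq \<Rightarrow> ('g, 'k) tens" where
  "left_coeff w = lin_ext pm_scale (\<lambda>(u, v). if u = w then Poly_Mapping.single v 1 else 0)"

interpretation left_coeff: Vector_Spaces.linear pm_scale pm_scale "left_coeff w"
  unfolding left_coeff_def by (rule linear_lin_ext) (rule pm.vector_space_axioms)

lemma left_coeff_single:
  "left_coeff w (Poly_Mapping.single (u, v) 1) = (if u = w then Poly_Mapping.single v 1 else 0)"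
  by (simp add: left_coeff_def lin_ext_single[OF pm.vector_space_axioms])

text \<open>On a pair of words \<open>(u, v)\<close> both sides are \<open>|v|\<close> if
  \<open>u\<close> is the single letter \<open>e\<close>, and zero otherwise. Contraction can thus
  be computed in \<open>T(H) \<otimes> T(H)\<close> before projecting.\<close>

lemma contract_to_trace_sq:
  fixes z :: "('g::finite, 'k::field) tens_sq"
  shows "contract e (omega_sq_to_trace_sq (to_omega_sq z)) = trace_class (left_coeff (Word [e]) z)"
proof (rule linear_from_pm_eq[of scale_trace_omega "\<lambda>z. contract e (omega_sq_to_trace_sq (to_omega_sq z))"
      "\<lambda>z. trace_class (left_coeff (Word [e]) z)"])
  fix b :: "'g symp word \<times> 'g symp word"
  show "contract e (omega_sq_to_trace_sq (to_omega_sq (Poly_Mapping.single b 1))) =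
      trace_class (left_coeff (Word [e]) (Poly_Mapping.single b 1 :: ('g, 'k) tens_sq))"
    by (cases b) (simp add: to_omega_sq_single omega_sq_to_trace_sq_tensor contract_tensor
        letter_coeff_trace_class left_coeff_single lookup_single trace_class.zero)
qed (rule linearI_pm, simp_all add: trace_omega.vector_space_axioms to_omega_sq.add to_omega_sq.scale
    omega_sq_to_trace_sq.add omega_sq_to_trace_sq.scale contract.add contract.scale
    left_coeff.add left_coeff.scale trace_class.add trace_class.scale)+

text \<open>The derivation of the proof idea, encoded as the part of the coproduct whose left factor
  is the single letter \<open>e\<close>. The recursion on words is
  \<open>delete_letter_monom\<close>.\<close>

definition delete_letter :: "'g symp \<Rightarrow> ('g, 'k::field) tens \<Rightarrow> ('g, 'k) tens" where
  "delete_letter e p = left_coeff (Word [e]) (coprod p)"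

lemma linear_delete_letter: "Vector_Spaces.linear pm_scale pm_scale (delete_letter e)"
  unfolding delete_letter_def
  by (rule linearI_pm) (simp_all add: pm.vector_space_axioms coprod.add coprod.scale left_coeff.add left_coeff.scale)

interpretation delete_letter: Vector_Spaces.linear pm_scale pm_scale "delete_letter e"
  by (rule linear_delete_letter)

lemma var_mult_monom: "var a * monom xs = monom (a # xs)"
  by (simp add: var_def mult_single plus_word_def)

lemma left_coeff_right_letter:
  fixes z :: "('g, 'k::field) tens_sq"
  shows "left_coeff w (Poly_Mapping.single (0, Word [a]) 1 * z) = var a * left_coeff w z"
proof (rule linear_from_pm_eq[of pm_scale "\<lambda>z. left_coeff w (Poly_Mapping.single (0, Word [a]) 1 * z)"
      "\<lambda>z. var a * left_coeff w z"])
  fix b :: "'g symp word \<times> 'g symp word"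
  show "left_coeff w (Poly_Mapping.single (0, Word [a]) 1 * Poly_Mapping.single b 1) =
      var a * (left_coeff w (Poly_Mapping.single b 1) :: ('g, 'k) tens)"
    by (cases b) (simp add: mult_single left_coeff_single var_def)
qed (rule linearI_pm, simp_all add: pm.vector_space_axioms distrib_left pm_scale_mult_right
    left_coeff.add left_coeff.scale)+

lemma left_coeff_left_letter:
  fixes z :: "('g, 'k::field) tens_sq"
  shows "left_coeff (Word [e]) (Poly_Mapping.single (Word [a], 0) 1 * z) = (if a = e then left_coeff 0 z else 0)"
proof (rule linear_from_pm_eq[of pm_scale "\<lambda>z. left_coeff (Word [e]) (Poly_Mapping.single (Word [a], 0) 1 * z)"
      "\<lambda>z. if a = e then left_coeff 0 z else 0"])
  fix b :: "'g symp word \<times> 'g symp word"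
  show "left_coeff (Word [e]) (Poly_Mapping.single (Word [a], 0) 1 * Poly_Mapping.single b 1) =
      (if a = e then left_coeff 0 (Poly_Mapping.single b 1) :: ('g, 'k) tens else 0)"
    by (cases b, cases "fst b") (auto simp: mult_single left_coeff_single plus_word_def zero_word_def)
qed (rule linearI_pm, simp_all add: pm.vector_space_axioms distrib_left pm_scale_mult_right
    left_coeff.add left_coeff.scale)+

lemma left_coeff_0_left_letter:
  fixes z :: "('g, 'k::field) tens_sq"
  shows "left_coeff 0 (Poly_Mapping.single (Word [a], 0) 1 * z) = 0"
proof (rule linear_from_pm_eq[of pm_scale "\<lambda>z. left_coeff 0 (Poly_Mapping.single (Word [a], 0) 1 * z)"
      "\<lambda>z. 0"])
  fix b :: "'g symp word \<times> 'g symp word"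
  show "left_coeff 0 (Poly_Mapping.single (Word [a], 0) 1 * Poly_Mapping.single b 1) = (0 :: ('g, 'k) tens)"
    by (cases b, cases "fst b") (auto simp: mult_single left_coeff_single plus_word_def zero_word_def)
qed (rule linearI_pm, simp_all add: pm.vector_space_axioms distrib_left pm_scale_mult_right
    left_coeff.add left_coeff.scale)+

lemma coprod_Nil: "coprod (monom []) = Poly_Mapping.single (0, 0) 1"
  by (simp add: coprod_def lin_ext_single[OF pm.vector_space_axioms] flip: zero_prod_def)

text \<open>This is the counit axiom: no term from the left summand \<open>a \<otimes> 1\<close> of
  a letter can have an empty left factor.\<close>

lemma left_coeff_0_coprod:
  fixes p :: "('g, 'k::field) tens"
  shows "left_coeff 0 (coprod p) = p"
proof (rule linear_from_pm_eq[of pm_scale "\<lambda>z. left_coeff 0 (coprod z)"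
      "\<lambda>z. z"])
  fix w :: "'g symp word"
  have "left_coeff 0 (coprod (monom xs)) = (monom xs :: ('g, 'k) tens)" for xs
  proof (induction xs)
    case Nil
    show ?case by (simp add: coprod_Nil left_coeff_single zero_word_def)
  next
    case (Cons a xs)
    then show ?case
      by (simp add: coprod_mult coprod_var distrib_right left_coeff.add left_coeff_right_letter
          left_coeff_0_left_letter flip: var_mult_monom)
  qed
  from this[of "letters w"] show "left_coeff 0 (coprod (Poly_Mapping.single w 1)) = (Poly_Mapping.single w 1 :: ('g, 'k) tens)"
    by simp
qed (rule linearI_pm, simp_all add: pm.vector_space_axioms coprod.add coprod.scale
    left_coeff.add left_coeff.scale)+

text \<open>In \<open>\<Delta>(a w) = (a \<otimes> 1 + 1 \<otimes> a) \<Delta>(w)\<close> the left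
  factor \<open>e\<close> comes either from the leading \<open>a\<close>, and then the counit axiom
  returns all of \<open>w\<close>, or from \<open>w\<close>, and then \<open>a\<close> stays in
  front on the right.\<close>

lemma delete_letter_monom [simp]:
  "delete_letter e (monom []) = 0"
  "delete_letter e (monom (a # xs)) = (if a = e then monom xs else 0) + var a * delete_letter e (monom xs)"
proof -
  show "delete_letter e (monom []) = 0"
    by (simp add: delete_letter_def coprod_Nil left_coeff_single zero_word_def)
  show "delete_letter e (monom (a # xs)) = (if a = e then monom xs else 0) + var a * delete_letter e (monom xs)"
    by (simp add: delete_letter_def coprod_mult coprod_var distrib_right left_coeff.add
        left_coeff_right_letter left_coeff_left_letter left_coeff_0_coprod flip: var_mult_monom)
qed

lemma delete_letter_in_tens_deg:
  fixes p :: "('g, 'k::field) tens"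
  shows "p \<in> tens_deg (Suc k) \<Longrightarrow> delete_letter e p \<in> tens_deg k"
proof (rule linear_mem_of_monom[OF linear_delete_letter subspace_tens_deg])
  fix xs :: "'g symp list"
  show "length xs = Suc k \<Longrightarrow> delete_letter e (monom xs) \<in> (tens_deg k :: ('g, 'k) tens set)"
  proof (induction xs arbitrary: k)
    case (Cons a xs)
    have "var a * delete_letter e (monom xs) \<in> (tens_deg k :: ('g, 'k) tens set)"
    proof (cases xs)
      case Nil
      then show ?thesis by (simp add: pm.subspace_0[OF subspace_tens_deg])
    next
      case (Cons b ys)
      then have "var a * delete_letter e (monom xs) \<in> (tens_deg (length [a] + length ys) :: ('g, 'k) tens set)"
        unfolding var_def by (intro mult_in_tens_deg monom_in_tens_deg Cons.IH) simp
      with Cons Cons.prems show ?thesis by simp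
    qed
    with Cons.prems monom_in_tens_deg[of xs] show ?case
      by (auto intro: pm.subspace_add[OF subspace_tens_deg])
  qed simp
qed

lemma red_coprod_to_omega:
  "red_coprod_omega (to_omega p) = to_omega_sq (coprod p) - tensor_omega (to_omega p) 1 - tensor_omega 1 (to_omega p)"
  by (simp add: red_coprod_omega_def coprod_omega_to_omega)

text \<open>Contraction with \<open>e\<close> kills both terms subtracted in the reduced coproduct:
  \<open>p\<close> has no component in degree one because \<open>d \<noteq> 1\<close>, and the dual
  of \<open>e\<close> vanishes at \<open>1\<close>. What remains is the contraction of the full
  coproduct.\<close>

lemma trace_class_delete_letter:
  fixes p :: "('g::finite, 'k::field) tens"
  assumes "trace_red_coprod (trace_class p) = 0" "p \<in> tens_deg d" "d \<noteq> 1"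
  shows "trace_class (delete_letter e p) = 0"
proof -
  have "Poly_Mapping.lookup p (Word [e]) = 0"
    using assms(2,3) by (force simp: tens_deg_def in_keys_iff)
  moreover have "letter_coeff e (tr (1 :: ('g, 'k) tens_omega)) = 0"
    using letter_coeff_trace_class[of e "1 :: ('g, 'k) tens"]
    by (simp add: one_tens_omega.abs_eq lookup_one when_def zero_word_def)
  moreover have "contract e (trace_red_coprod (trace_class p)) = 0"
    by (simp add: assms(1) contract.zero)
  ultimately show ?thesis
    by (simp add: trace_red_coprod_tr red_coprod_to_omega omega_sq_to_trace_sq.diff contract.diff
        omega_sq_to_trace_sq_tensor contract_tensor contract_to_trace_sq letter_coeff_trace_class
        delete_letter_def)
qed

section \<open>Reconstruction from the deleted letters\<close>

interpretation tr: Vector_Spaces.linear pm_scale scale_trace tr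
  by (rule linear_tr)

lemma tr_eq_0_iff: "tr p = 0 \<longleftrightarrow> p \<in> comm_span" for p :: "'b::monoid_add \<Rightarrow>\<^sub>0 'k::field"
  using tr_eq_iff[of p 0] by (simp add: tr.zero)

lemma tr_monom_append: "tr (monom (xs @ ys)) = tr (monom (ys @ xs))"
  using tr_mult_commute[of "monom xs" "monom ys"] by (simp add: mult_single plus_word_def)

text \<open>The cyclic symmetrisation. It kills commutators, hence gives a map from
  \<open>|T(H)|\<close> back to \<open>T(H)\<close>; after it a letter can be inserted into a cyclic
  word by multiplication from the left.\<close>

definition rotations :: "('g, 'k::field) tens \<Rightarrow> ('g, 'k) tens" where
  "rotations = lin_ext pm_scale (\<lambda>w. \<Sum>i<length (letters w). monom (rotate i (letters w)))"

definition reversal :: "('g, 'k::field) tens \<Rightarrow> ('g, 'k) tens" where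
  "reversal = lin_ext pm_scale (\<lambda>w. monom (rev (letters w)))"

interpretation rotations: Vector_Spaces.linear pm_scale pm_scale rotations
  unfolding rotations_def by (rule linear_lin_ext) (rule pm.vector_space_axioms)

interpretation reversal: Vector_Spaces.linear pm_scale pm_scale reversal
  unfolding reversal_def by (rule linear_lin_ext) (rule pm.vector_space_axioms)

lemma rotations_monom: "rotations (monom xs) = (\<Sum>i<length xs. monom (rotate i xs))"
  by (simp add: rotations_def lin_ext_single[OF pm.vector_space_axioms])

lemma reversal_monom [simp]: "reversal (monom xs) = monom (rev xs)"
  by (simp add: reversal_def lin_ext_single[OF pm.vector_space_axioms])

text \<open>The sum runs over a full period, so shifting the rotation index does not change it;
  rotating \<open>xs @ ys\<close> by the length of \<open>xs\<close> gives
  \<open>ys @ xs\<close>.\<close>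

lemma rotations_monom_append: "rotations (monom (xs @ ys)) = rotations (monom (ys @ xs))"
proof -
  have "(\<Sum>i<length zs. monom (rotate (i + k) zs) :: ('a, 'b) tens) = (\<Sum>i<length zs. monom (rotate i zs))"
    for zs k
  proof (induction k)
    case (Suc k)
    have "monom (rotate k zs) + (\<Sum>i<length zs. monom (rotate (Suc i + k) zs) :: ('a, 'b) tens) =
        (\<Sum>i<Suc (length zs). monom (rotate (i + k) zs))"
      by (subst sum.lessThan_Suc_shift) simp
    \<comment> \<open>The top index \<open>length zs\<close> contributes a full turn, so its term
      equals the one of index \<open>0\<close>.\<close>
    also have "\<dots> = monom (rotate k zs) + (\<Sum>i<length zs. monom (rotate (i + k) zs))"
      by (simp add: add.commute flip: rotate_rotate)
    finally show ?case using Suc by (simp add: add.assoc)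
  qed simp
  from this[of "length xs" "xs @ ys"] show ?thesis
    by (simp add: rotations_monom rotate_append add.commute flip: rotate_rotate)
qed

text \<open>On cyclic words of length three this combines the symmetric and the alternating part with
  the weights that make \<open>sum_insert_delete_4\<close> hold.\<close>

definition dihedral :: "('g, 'k::field) tens \<Rightarrow> ('g, 'k) tens" where
  "dihedral p = rotations p + rotations p - rotations (reversal p)"

lemma linear_dihedral: "Vector_Spaces.linear pm_scale pm_scale dihedral"
  unfolding dihedral_def
  by (rule linearI_pm) (simp_all add: pm.vector_space_axioms rotations.add rotations.scale
      reversal.add reversal.scale pm.scale_right_distrib pm.scale_right_diff_distrib)

interpretation dihedral: Vector_Spaces.linear pm_scale pm_scale dihedral
  by (rule linear_dihedral)

lemma rotations_comm_span: "p \<in> comm_span \<Longrightarrow> rotations p = 0"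
  by (rule linear_vanishes_on_comm_span[OF rotations.linear_axioms rotations_monom_append])

text \<open>Reversal sends \<open>xs @ ys\<close> to \<open>rev ys @ rev xs\<close>, so it carries
  rotations of a word to rotations of the reversed word.\<close>

lemma dihedral_comm_span: "p \<in> comm_span \<Longrightarrow> dihedral p = 0"
proof (rule linear_vanishes_on_comm_span[OF linear_dihedral])
  show "dihedral (monom (xs @ ys)) = dihedral (monom (ys @ xs))" for xs ys :: "'a symp list"
    by (simp add: dihedral_def rotations_monom_append[of xs ys]
        rotations_monom_append[of "rev ys" "rev xs"])
qed

section \<open>Reinsertion identities in degrees two, three and four\<close>

lemma delete_letter_monom_sum:
  "delete_letter e (monom xs) =
    (\<Sum>i<length xs. if xs ! i = e then monom (take i xs @ drop (Suc i) xs) else 0)"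
proof (induction xs)
  case (Cons a xs)
  show ?case
    by (simp add: Cons sum.lessThan_Suc_shift sum_distrib_left var_mult_monom if_distrib cong: if_cong
        del: sum.lessThan_Suc)
qed simp

text \<open>At each position only the letter standing there contributes, which turns the sum over
  letters into a sum over positions.\<close>

lemma sum_insert_delete_monom:
  fixes F :: "('g::finite, 'k::field) tens \<Rightarrow> ('g, 'k) tens"
  assumes "Vector_Spaces.linear pm_scale pm_scale F"
  shows "(\<Sum>e\<in>UNIV. var e * F (delete_letter e (monom xs))) =
    (\<Sum>i<length xs. var (xs ! i) * F (monom (take i xs @ drop (Suc i) xs)))"
proof -
  interpret F: Vector_Spaces.linear pm_scale pm_scale F by fact
  have "var e * F (if x = e then p else 0) = (if x = e then var x * F p else 0)" for e x p
    by (simp add: F.zero)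
  then show ?thesis
    by (simp add: delete_letter_monom_sum F.sum sum_distrib_left sum.swap[of _ _ UNIV])
qed

lemma linear_sum_insert_delete:
  fixes F :: "('g::finite, 'k::field) tens \<Rightarrow> ('g, 'k) tens"
  assumes "Vector_Spaces.linear pm_scale pm_scale F"
  shows "Vector_Spaces.linear pm_scale pm_scale (\<lambda>p. \<Sum>e\<in>UNIV. var e * F (delete_letter e p))"
proof -
  interpret F: Vector_Spaces.linear pm_scale pm_scale F by fact
  show ?thesis
    by (rule linearI_pm) (simp_all add: pm.vector_space_axioms delete_letter.add delete_letter.scale
        F.add F.scale distrib_left sum.distrib pm_scale_mult_right pm.scale_sum_right)
qed

text \<open>For a word \<open>ab\<close> the sum is \<open>ab + ba\<close>, and both terms have the
  same trace.\<close>

lemma sum_insert_delete_2: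
  fixes p :: "('g::finite, 'k::field) tens"
  assumes "p \<in> tens_deg 2"
  shows "p + p - (\<Sum>e\<in>UNIV. var e * delete_letter e p) \<in> comm_span"
proof (rule linear_mem_of_monom[of pm_scale "\<lambda>p. p + p - (\<Sum>e\<in>UNIV. var e * delete_letter e p)",
      OF _ subspace_comm_span _ assms])
  interpret S: Vector_Spaces.linear pm_scale pm_scale
    "\<lambda>p. \<Sum>e\<in>UNIV. var e * delete_letter e (p :: ('g, 'k) tens)"
    using linear_sum_insert_delete[OF pm.linear_ident] .
  show "Vector_Spaces.linear pm_scale pm_scale
      (\<lambda>p :: ('g, 'k) tens. p + p - (\<Sum>e\<in>UNIV. var e * delete_letter e p))"
    by (rule linearI_pm) (simp_all add: pm.vector_space_axioms S.add S.scale
        pm.scale_right_distrib pm.scale_right_diff_distrib)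
  fix xs :: "'g symp list" assume "length xs = 2"
  then obtain a b where xs: "xs = [a, b]" by (auto simp: numeral_2_eq_2 length_Suc_conv)
  have "tr (monom [b, a] :: ('g, 'k) tens) = tr (monom [a, b])"
    using tr_monom_append[of "[b]" "[a]"] by simp
  then show "monom xs + monom xs - (\<Sum>e\<in>UNIV. var e * delete_letter e (monom xs)) \<in> (comm_span :: ('g, 'k) tens set)"
    unfolding xs sum_insert_delete_monom[OF pm.linear_ident]
    by (simp add: lessThan_Suc var_mult_monom tr.add tr.diff
        flip: tr_eq_0_iff)
qed

lemma bracket_monom:
  "bracket (var a) (var b) = monom [a, b] - monom [b, a]"
  "bracket (var a) (bracket (var b) (var c)) =
    monom [a, b, c] - monom [a, c, b] - monom [b, c, a] + monom [c, b, a]"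
  by (simp_all add: bracket_def var_def mult_single plus_word_def algebra_simps)

lemma twist_monom: "twist (monom [a, b, c]) = monom [a, b, c] - monom [a, c, b]"
  by (simp add: twist_def lin_ext_single[OF pm.vector_space_axioms] bracket_monom right_diff_distrib
      var_mult_monom)

text \<open>For a word \<open>abc\<close> the sum runs over all six permutations, so its trace is
  \<open>3|abc| + 3|acb|\<close>. Subtracting it from \<open>6|abc|\<close> leaves
  \<open>3|a[b, c]|\<close>.\<close>

lemma sum_insert_delete_3:
  fixes p :: "('g::finite, 'k::field) tens"
  assumes "p \<in> tens_deg 3"
  shows "pm_scale 6 p - (\<Sum>e\<in>UNIV. var e * rotations (delete_letter e p)) - pm_scale 3 (twist p) \<in> comm_span"
proof (rule linear_mem_of_monom[of pm_scale
      "\<lambda>p. pm_scale 6 p - (\<Sum>e\<in>UNIV. var e * rotations (delete_letter e p)) - pm_scale 3 (twist p)",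
      OF _ subspace_comm_span _ assms])
  interpret S: Vector_Spaces.linear pm_scale pm_scale
    "\<lambda>p. \<Sum>e\<in>UNIV. var e * rotations (delete_letter e (p :: ('g, 'k) tens))"
    using linear_sum_insert_delete[OF rotations.linear_axioms] .
  show "Vector_Spaces.linear pm_scale pm_scale
      (\<lambda>p :: ('g, 'k) tens. pm_scale 6 p - (\<Sum>e\<in>UNIV. var e * rotations (delete_letter e p)) - pm_scale 3 (twist p))"
    by (rule linearI_pm) (simp_all add: pm.vector_space_axioms S.add S.scale twist.add twist.scale
        pm.scale_right_distrib pm.scale_right_diff_distrib mult.commute)
  fix xs :: "'g symp list" assume "length xs = 3"
  then obtain a b c where xs: "xs = [a, b, c]" by (auto simp: numeral_3_eq_3 length_Suc_conv)
  have rot: "tr (monom [x, a, y] :: ('g, 'k) tens) = tr (monom [a, y, x])"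
    "tr (monom [x, y, a] :: ('g, 'k) tens) = tr (monom [a, x, y])" for x y
    using tr_monom_append[of "[x]" "[a, y]"] tr_monom_append[of "[x, y]" "[a]"] by simp_all
  have scale: "pm_scale 3 q = q + q + q" "pm_scale 6 q = q + q + q + q + q + q" for q :: "('g, 'k) tens"
    by (rule poly_mapping_eqI, simp add: lookup_add)+
  show "pm_scale 6 (monom xs) - (\<Sum>e\<in>UNIV. var e * rotations (delete_letter e (monom xs)))
      - pm_scale 3 (twist (monom xs)) \<in> (comm_span :: ('g, 'k) tens set)"
    unfolding scale xs sum_insert_delete_monom[OF rotations.linear_axioms]
    by (simp add: lessThan_Suc rotations_monom twist_monom distrib_left var_mult_monom tr.add tr.diff
        tr.neg rot del: pm_scale_single flip: tr_eq_0_iff)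
qed

text \<open>As \<open>- [d, [b, c]] = [[b, c], d]\<close>, the second factor is the sum of the two
  bracketings of \<open>b, c, d\<close> in this order.\<close>

definition nested_twist :: "('g, 'k::field) tens \<Rightarrow> ('g, 'k) tens" where
  "nested_twist = lin_ext pm_scale (\<lambda>w. case letters w of
    [a, b, c, d] \<Rightarrow> var a * (bracket (var b) (bracket (var c) (var d)) - bracket (var d) (bracket (var b) (var c)))
    | _ \<Rightarrow> 0)"

interpretation nested_twist: Vector_Spaces.linear pm_scale pm_scale nested_twist
  unfolding nested_twist_def by (rule linear_lin_ext) (rule pm.vector_space_axioms)

lemma nested_twist_monom:
  "nested_twist (monom [a, b, c, d]) =
    var a * (bracket (var b) (bracket (var c) (var d)) - bracket (var d) (bracket (var b) (var c)))"
  by (simp add: nested_twist_def lin_ext_single[OF pm.vector_space_axioms])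

text \<open>Rotating \<open>a\<close> to the front leaves six cyclic words. The sum has trace
  \<open>8|abcd| - 4|adcb|\<close> plus twice each of the other four; subtracted from
  \<open>12|abcd|\<close>, this is \<open>4|abcd| + 4|adcb|\<close> minus twice each of the others,
  which is exactly the trace of twice \<open>nested_twist\<close>.\<close>

lemma sum_insert_delete_4:
  fixes p :: "('g::finite, 'k::field) tens"
  assumes "p \<in> tens_deg 4"
  shows "pm_scale 12 p - (\<Sum>e\<in>UNIV. var e * dihedral (delete_letter e p)) - pm_scale 2 (nested_twist p) \<in> comm_span"
proof (rule linear_mem_of_monom[of pm_scale
      "\<lambda>p. pm_scale 12 p - (\<Sum>e\<in>UNIV. var e * dihedral (delete_letter e p)) - pm_scale 2 (nested_twist p)",
      OF _ subspace_comm_span _ assms])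
  interpret S: Vector_Spaces.linear pm_scale pm_scale
    "\<lambda>p. \<Sum>e\<in>UNIV. var e * dihedral (delete_letter e (p :: ('g, 'k) tens))"
    using linear_sum_insert_delete[OF linear_dihedral] .
  show "Vector_Spaces.linear pm_scale pm_scale
      (\<lambda>p :: ('g, 'k) tens. pm_scale 12 p - (\<Sum>e\<in>UNIV. var e * dihedral (delete_letter e p)) - pm_scale 2 (nested_twist p))"
    by (rule linearI_pm) (simp_all add: pm.vector_space_axioms S.add S.scale nested_twist.add nested_twist.scale
        pm.scale_right_distrib pm.scale_right_diff_distrib mult.commute)
  fix xs :: "'g symp list" assume "length xs = 4"
  then obtain a b c d where xs: "xs = [a, b, c, d]" by (auto simp: eval_nat_numeral length_Suc_conv)
  \<comment> \<open>These rotations bring every cyclic word to the form that starts with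
    \<open>a\<close>, after which the coefficients can be compared.\<close>
  have rot: "tr (monom [x, a, y, z] :: ('g, 'k) tens) = tr (monom [a, y, z, x])"
    "tr (monom [x, y, a, z] :: ('g, 'k) tens) = tr (monom [a, z, x, y])"
    "tr (monom [x, y, z, a] :: ('g, 'k) tens) = tr (monom [a, x, y, z])" for x y z
    using tr_monom_append[of "[x]" "[a, y, z]"] tr_monom_append[of "[x, y]" "[a, z]"]
      tr_monom_append[of "[x, y, z]" "[a]"] by simp_all
  have scale: "pm_scale 2 q = q + q"
    "pm_scale 12 q = q + q + q + q + q + q + q + q + q + q + q + q" for q :: "('g, 'k) tens"
    by (rule poly_mapping_eqI, simp add: lookup_add)+
  show "pm_scale 12 (monom xs) - (\<Sum>e\<in>UNIV. var e * dihedral (delete_letter e (monom xs)))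
      - pm_scale 2 (nested_twist (monom xs)) \<in> (comm_span :: ('g, 'k) tens set)"
    unfolding scale xs sum_insert_delete_monom[OF linear_dihedral] nested_twist_monom bracket_monom(2)
    by (simp add: lessThan_Suc dihedral_def rotations_monom distrib_left right_diff_distrib var_mult_monom
        tr.add tr.diff tr.neg rot del: pm_scale_single flip: tr_eq_0_iff)
qed

section \<open>Primitive elements\<close>

lemma left_factor_mult: "left_factor (p * q) = left_factor p * left_factor q"
  by (rule bilinear_from_pm_eq[of pm_scale "\<lambda>p q. left_factor (p * q)" "\<lambda>p q. left_factor p * left_factor q"])
    (auto intro!: linearI_pm pm.vector_space_axioms simp: distrib_left distrib_right left_factor.add
      left_factor.scale pm_scale_mult_left pm_scale_mult_right mult_single left_factor_single)

lemma right_factor_mult: "right_factor (p * q) = right_factor p * right_factor q"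
  by (rule bilinear_from_pm_eq[of pm_scale "\<lambda>p q. right_factor (p * q)" "\<lambda>p q. right_factor p * right_factor q"])
    (auto intro!: linearI_pm pm.vector_space_axioms simp: distrib_left distrib_right right_factor.add
      right_factor.scale pm_scale_mult_left pm_scale_mult_right mult_single right_factor_single)

lemma right_factor_mult_left_factor: "right_factor q * left_factor p = left_factor p * right_factor q"
  by (rule bilinear_from_pm_eq[of pm_scale "\<lambda>p q. right_factor q * left_factor p"
        "\<lambda>p q. left_factor p * right_factor q"])
    (auto intro!: linearI_pm pm.vector_space_axioms simp: distrib_left distrib_right right_factor.add
      right_factor.scale left_factor.add left_factor.scale pm_scale_mult_left pm_scale_mult_right
      mult_single left_factor_single right_factor_single)

lemma to_omega_sq_factors:
  "to_omega_sq (left_factor p * right_factor q) = tensor_omega (to_omega p) (to_omega q)"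
  by (rule bilinear_from_pm_eq[of scale_omega_sq "\<lambda>p q. to_omega_sq (left_factor p * right_factor q)"
        "\<lambda>p q. tensor_omega (to_omega p) (to_omega q)"])
    (auto intro!: linearI_pm omega_sq.vector_space_axioms simp: distrib_left distrib_right right_factor.add
      right_factor.scale left_factor.add left_factor.scale pm_scale_mult_left pm_scale_mult_right
      to_omega_sq.add to_omega_sq.scale to_omega.add to_omega.scale tensor_omega_bilinear
      mult_single left_factor_single right_factor_single to_omega_sq_single)

lemma factor_one: "left_factor 1 = 1" "right_factor 1 = 1"
  using left_factor_single[of 0] right_factor_single[of 0] by (simp_all flip: zero_prod_def)

lemma to_omega_sq_left_right:
  "to_omega_sq (left_factor p) = tensor_omega (to_omega p) 1"
  "to_omega_sq (right_factor p) = tensor_omega 1 (to_omega p)"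
  using to_omega_sq_factors[of p 1] to_omega_sq_factors[of 1 p]
  by (simp_all add: factor_one one_tens_omega.abs_eq)

lemma coprod_HH:
  assumes "h \<in> HH" shows "coprod h = left_factor h + right_factor h"
proof -
  have *: "coprod (var a) = left_factor (var a) + right_factor (var a)" for a
    by (simp add: coprod_var) (simp add: var_def left_factor_single right_factor_single)
  from assms show ?thesis
    unfolding HH_def
    by (induction rule: pm.span_induct_alt)
      (auto simp: * coprod.add coprod.scale left_factor.add left_factor.scale right_factor.add
        right_factor.scale pm.scale_right_distrib algebra_simps)
qed

text \<open>Letters are primitive, and the commutator of two primitive elements is primitive because
  \<open>p \<otimes> 1\<close> and \<open>1 \<otimes> q\<close> commute, so that the mixed terms
  cancel.\<close>

lemma coprod_free_lie: "l \<in> free_lie \<Longrightarrow> coprod l = left_factor l + right_factor l"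
proof (induction rule: free_lie.induct)
  case (gen h)
  then show ?case by (rule coprod_HH)
next
  case (bracket p q)
  then show ?case
    by (simp add: bracket_def coprod.diff coprod_mult left_factor.diff right_factor.diff
        distrib_left distrib_right left_factor_mult right_factor_mult right_factor_mult_left_factor)
qed (simp_all add: coprod.add coprod.scale left_factor.add left_factor.scale right_factor.add
    right_factor.scale pm.scale_right_distrib)

section \<open>The traces of \<open>H L(H)\<close> lie in the kernel\<close>

lemma free_lie_HH_plus_comm_span: "l \<in> free_lie \<Longrightarrow> \<exists>h\<in>HH. l - h \<in> comm_span"
proof (induction rule: free_lie.induct)
  case (gen h)
  then show ?case using comm_span.zero by force
next
  case (add p q)
  then obtain h k where *: "h \<in> HH" "p - h \<in> comm_span" "k \<in> HH" "q - k \<in> comm_span" by auto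
  have "p + q - (h + k) \<in> comm_span" using comm_span_add[OF *(2,4)] by (simp add: algebra_simps)
  moreover have "h + k \<in> HH" using * by (simp add: HH_def pm.span_add)
  ultimately show ?case by blast
next
  case (scale p c)
  then obtain h where *: "h \<in> HH" "p - h \<in> comm_span" by auto
  have "pm_scale c p - pm_scale c h \<in> comm_span"
    using pm.subspace_scale[OF subspace_comm_span *(2)] by (simp add: pm.scale_right_diff_distrib)
  moreover have "pm_scale c h \<in> HH" using * by (simp add: HH_def pm.span_scale)
  ultimately show ?case by blast
next
  case (bracket p q)
  show ?case
    by (rule bexI[of _ 0]) (simp_all add: comm_span_bracket HH_def pm.span_zero)
qed

text \<open>A Lie element is an element of \<open>H\<close> plus commutators. Projection to degree
  \<open>d \<noteq> 1\<close> removes the part in \<open>H\<close> and preserves the commutator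
  span.\<close>

lemma free_lie_in_comm_span:
  assumes "l \<in> free_lie" "l \<in> tens_deg d" "d \<noteq> 1" shows "l \<in> comm_span"
proof -
  obtain h where h: "h \<in> HH" "l - h \<in> comm_span" using free_lie_HH_plus_comm_span assms(1) by blast
  then have "h \<in> tens_deg 1" using HH_le_tens_deg by blast
  with comm_span_proj[OF h(2), of d] assms(2,3) show ?thesis by (simp add: proj.diff proj_tens_deg)
qed

lemma tensor_trace_zero: "tensor_trace 0 b = 0" "tensor_trace a 0 = 0"
  using tensor_trace_bilinear(1)[of 0 0 b] tensor_trace_bilinear(2)[of a 0 0] by simp_all

lemma trace_red_coprod_trace_class:
  "trace_red_coprod (trace_class p) =
    omega_sq_to_trace_sq (to_omega_sq (coprod p) - tensor_omega (to_omega p) 1 - tensor_omega 1 (to_omega p))"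
  by (simp add: trace_red_coprod_tr red_coprod_to_omega)

lemma trace_red_coprod_HH: "h \<in> HH \<Longrightarrow> trace_red_coprod (trace_class h) = 0"
  by (simp add: trace_red_coprod_trace_class coprod_HH to_omega_sq.add to_omega_sq_left_right
      omega_sq_to_trace_sq.zero)

lemma linear_trace_red_coprod: "Vector_Spaces.linear pm_scale scale_trace_sq (\<lambda>p. trace_red_coprod (trace_class p))"
  unfolding trace_red_coprod_trace_class
  by (rule linearI_pm)
    (simp_all add: trace_sq.vector_space_axioms
      coprod.add coprod.scale to_omega_sq.add to_omega_sq.scale to_omega.add to_omega.scale
      tensor_omega_bilinear omega_sq_to_trace_sq.add omega_sq_to_trace_sq.diff
      omega_sq_to_trace_sq.scale trace_sq.scale_right_diff_distrib)

text \<open>Both factors are primitive, so the reduced coproduct of \<open>h l\<close> is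
  \<open>h \<otimes> l + l \<otimes> h\<close>. Each term contains \<open>|l|\<close>, which is zero
  because \<open>d \<noteq> 1\<close>.\<close>

lemma trace_red_coprod_HH_mult_free_lie:
  assumes "h \<in> HH" "l \<in> free_lie" "l \<in> tens_deg d" "d \<noteq> 1"
  shows "trace_red_coprod (trace_class (h * l)) = 0"
proof -
  have "trace_class l = 0"
    using free_lie_in_comm_span[OF assms(2-4)] by (rule trace_class_comm_span)
  then show ?thesis
    by (simp add: trace_red_coprod_trace_class coprod_mult coprod_HH assms(1)
        coprod_free_lie[OF assms(2)] distrib_left distrib_right to_omega_sq.add to_omega_sq_factors
        right_factor_mult_left_factor to_omega_sq_left_right
        omega_sq_to_trace_sq.add omega_sq_to_trace_sq.diff
        omega_sq_to_trace_sq_tensor tensor_trace_zero flip: left_factor_mult right_factor_mult)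
qed

abbreviation HH_lie :: "nat \<Rightarrow> ('g, 'k::field) tens set" where
  "HH_lie k \<equiv> {h * l | h l. h \<in> HH \<and> l \<in> free_lie \<inter> tens_deg k}"

lemma trace_prod_lie:
  "trace_prod scale_omega (to_omega ` HH) (lie_to_tens_omega ` lie_omega_deg k) =
    (trace_class ` pm.span (HH_lie k) :: ('g::finite, 'k::field) tens_omega trace set)"
proof -
  have "lie_to_tens_omega ` lie_omega_deg k = (to_omega ` (free_lie \<inter> tens_deg k) :: ('g, 'k) tens_omega set)"
    unfolding lie_omega_deg_def image_image by (rule image_cong) (auto simp: lie_to_tens_omega)
  then have "{a * b | a b. a \<in> to_omega ` HH \<and> b \<in> lie_to_tens_omega ` lie_omega_deg k} =
      (to_omega ` HH_lie k :: ('g, 'k) tens_omega set)"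
    by (force simp: to_omega_mult)
  then show ?thesis
    by (simp add: trace_prod_def to_omega.span_image image_image)
qed

lemma HH_lie_subset_tens_deg: "HH_lie k \<subseteq> tens_deg (Suc k)"
  using mult_in_tens_deg[of _ 1 _ k] HH_le_tens_deg by auto

lemma HH_lie_subset_Ker:
  assumes "k \<noteq> 1"
  shows "trace_class ` pm.span (HH_lie k) \<subseteq> (Ker_deg (Suc k) :: ('g::finite, 'k::field) tens_omega trace set)"
proof -
  interpret K: Vector_Spaces.linear pm_scale scale_trace_sq
    "\<lambda>p. trace_red_coprod (trace_class (p :: ('g, 'k) tens))"
    by (rule linear_trace_red_coprod)
  have "pm.span (HH_lie k) \<subseteq> tens_deg (Suc k) \<inter> {p :: ('g, 'k) tens. trace_red_coprod (trace_class p) = 0}"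
  proof (rule pm.span_minimal)
    show "HH_lie k \<subseteq> tens_deg (Suc k) \<inter> {p :: ('g, 'k) tens. trace_red_coprod (trace_class p) = 0}"
      using HH_lie_subset_tens_deg assms by (auto simp: trace_red_coprod_HH_mult_free_lie)
    show "pm.subspace (tens_deg (Suc k) \<inter> {p :: ('g, 'k) tens. trace_red_coprod (trace_class p) = 0})"
      by (intro pm.subspace_inter subspace_tens_deg K.subspace_kernel)
  qed
  then show ?thesis by (auto simp: Ker_deg_def trace_omega_deg_def)
qed

section \<open>Degree four: the multiples of the symplectic form\<close>

text \<open>The three coefficients belong to the rotations of one word, so their sum is a functional
  on cyclic words of length three.\<close>

lemma cyclic_lookup_comm_span:
  fixes q :: "('g, 'k::field) tens"
  assumes "q \<in> comm_span"
  shows "Poly_Mapping.lookup q (Word [b, c, d]) + Poly_Mapping.lookup q (Word [c, d, b]) +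
    Poly_Mapping.lookup q (Word [d, b, c]) = 0"
proof (rule linear_vanishes_on_comm_span[OF _ _ assms,
      of "(*)" "\<lambda>q. Poly_Mapping.lookup q (Word [b, c, d]) + Poly_Mapping.lookup q (Word [c, d, b]) +
        Poly_Mapping.lookup q (Word [d, b, c])"])
  show "Vector_Spaces.linear pm_scale (*) (\<lambda>q :: ('g, 'k) tens. Poly_Mapping.lookup q (Word [b, c, d]) +
      Poly_Mapping.lookup q (Word [c, d, b]) + Poly_Mapping.lookup q (Word [d, b, c]))"
    by (rule linearI_pm) (simp_all add: vector_space_times lookup_add distrib_left)
  fix xs ys :: "'g symp list"
  let ?L = "\<lambda>zs. Poly_Mapping.lookup (monom zs :: ('g, 'k) tens) (Word [b, c, d]) +
    Poly_Mapping.lookup (monom zs :: ('g, 'k) tens) (Word [c, d, b]) +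
    Poly_Mapping.lookup (monom zs :: ('g, 'k) tens) (Word [d, b, c])"
  have shift: "Poly_Mapping.lookup (monom [x, y, z] :: ('g, 'k) tens) (Word [u, v, w]) =
      Poly_Mapping.lookup (monom [y, z, x]) (Word [v, w, u])" for x y z u v w
    by (auto simp: lookup_single when_def)
  have rot: "?L [x, y, z] = ?L [y, z, x]" for x y z
    by (simp only: shift[of x y z] add.commute add.left_commute)
  have other: "Poly_Mapping.lookup (monom zs :: ('g, 'k) tens) (Word [u, v, w]) = 0"
    if "length zs \<noteq> 3" for zs u v w
    using that by (simp add: lookup_single when_def) auto
  show "?L (xs @ ys) = ?L (ys @ xs)"
  proof (cases "length xs + length ys = 3")
    case True
    show ?thesis
    proof (cases "xs = [] \<or> ys = []")
      case True
      then show ?thesis by auto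
    next
      case False
      then obtain x xs' y ys' where *: "xs = x # xs'" "ys = y # ys'" by (auto simp: neq_Nil_conv)
      with True have "length xs' + length ys' = 1" by simp
      \<comment> \<open>Two nonempty parts of total length three have lengths one and two, in either
        order; each exchange is a rotation by one letter.\<close>
      then consider z where "xs' = []" "ys' = [z]" | z where "xs' = [z]" "ys' = []"
        by (cases xs') (auto simp: length_Suc_conv)
      then show ?thesis
        by cases (simp_all only: * append.simps rot[of x y] rot[of y x])
    qed
  next
    case False
    then have "length (xs @ ys) \<noteq> 3" "length (ys @ xs) \<noteq> 3" by auto
    from this[THEN other] show ?thesis by (simp only:)
  qed
qed

lemma lookup_var_mult:
  fixes q :: "('g, 'k::field) tens"
  shows "Poly_Mapping.lookup (var a * q) (Word (b # xs)) = (if a = b then Poly_Mapping.lookup q (Word xs) else 0)"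
proof (rule linear_from_pm_eq[of "(*)" "\<lambda>q. Poly_Mapping.lookup (var a * q) (Word (b # xs))"
      "\<lambda>q. if a = b then Poly_Mapping.lookup q (Word xs) else 0"])
  fix w :: "'g symp word"
  show "Poly_Mapping.lookup (var a * Poly_Mapping.single w 1) (Word (b # xs)) =
      (if a = b then Poly_Mapping.lookup (Poly_Mapping.single w (1 :: 'k)) (Word xs) else 0)"
    by (cases w) (auto simp: var_mult_monom lookup_single when_def)
qed (rule linearI_pm, simp_all add: vector_space_times distrib_left lookup_add pm_scale_mult_right)+

lemma HH_expand:
  fixes h :: "('g::finite, 'k::field) tens"
  assumes "h \<in> HH" shows "h = (\<Sum>b\<in>UNIV. pm_scale (Poly_Mapping.lookup h (Word [b])) (var b))"
proof (rule linear_eq_of_monom[of pm_scale "\<lambda>h. h"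
      "\<lambda>h. \<Sum>b\<in>UNIV. pm_scale (Poly_Mapping.lookup h (Word [b])) (var b)" 1])
  show "Vector_Spaces.linear pm_scale pm_scale
      (\<lambda>h :: ('g, 'k) tens. \<Sum>b\<in>UNIV. pm_scale (Poly_Mapping.lookup h (Word [b])) (var b))"
    by (rule linearI_pm) (simp_all add: pm.vector_space_axioms lookup_add pm.scale_left_distrib
        sum.distrib pm.scale_sum_right)
  fix xs :: "'g symp list" assume "length xs = 1"
  then obtain a where "xs = [a]" by (auto simp: length_Suc_conv)
  then show "monom xs = (\<Sum>b\<in>UNIV. pm_scale (Poly_Mapping.lookup (monom xs) (Word [b])) (var b) :: ('g, 'k) tens)"
    by (simp add: lookup_single when_def if_distrib[of "\<lambda>c. pm_scale c _"] var_def cong: if_cong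
        del: pm_scale_single)
qed (use assms in \<open>simp_all add: pm.linear_ident flip: tens_deg_1\<close>)

lemma lookup_HH_mult:
  fixes h :: "('g::finite, 'k::field) tens"
  assumes "h \<in> HH"
  shows "Poly_Mapping.lookup (h * q) (Word (b # xs)) =
    Poly_Mapping.lookup h (Word [b]) * Poly_Mapping.lookup q (Word xs)"
  by (subst HH_expand[OF assms])
    (simp add: sum_distrib_right lookup_sum pm_scale_mult_left lookup_var_mult if_distrib cong: if_cong)

lemma lookup_omega:
  "Poly_Mapping.lookup omega (Word [X i, Y j]) = (if i = j then 1 else 0)"
  "Poly_Mapping.lookup omega (Word [Y i, X j]) = (if i = j then - 1 else 0)"
  "Poly_Mapping.lookup omega (Word [X i, X j]) = 0"
  "Poly_Mapping.lookup omega (Word [Y i, Y j]) = 0"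
  by (cases "i = j"; auto simp: omega_monom lookup_sum lookup_minus lookup_single when_def
      sum_subtractf sum_negf intro!: sum.neutral)+

lemma lookup_monom_Cons:
  "Poly_Mapping.lookup (monom (a # xs)) (Word (b # ys)) =
    (if a = b then Poly_Mapping.lookup (monom xs) (Word ys) else 0)"
  by (simp add: lookup_single when_def)

text \<open>Deletion is dual to insertion: \<open>bcd\<close> arises from the words obtained by
  inserting \<open>e\<close> at one of its four places.\<close>

lemma lookup_delete_letter:
  fixes p :: "('g, 'k::field) tens"
  assumes "p \<in> tens_deg 4"
  shows "Poly_Mapping.lookup (delete_letter e p) (Word [b, c, d]) =
    Poly_Mapping.lookup p (Word [e, b, c, d]) + Poly_Mapping.lookup p (Word [b, e, c, d]) +
    Poly_Mapping.lookup p (Word [b, c, e, d]) + Poly_Mapping.lookup p (Word [b, c, d, e])"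
proof (rule linear_eq_of_monom[OF _ _ _ assms,
      of "(*)" "\<lambda>p. Poly_Mapping.lookup (delete_letter e p) (Word [b, c, d])"
      "\<lambda>p. Poly_Mapping.lookup p (Word [e, b, c, d]) + Poly_Mapping.lookup p (Word [b, e, c, d]) +
        Poly_Mapping.lookup p (Word [b, c, e, d]) + Poly_Mapping.lookup p (Word [b, c, d, e])"])
  fix xs :: "'g symp list" assume "length xs = 4"
  then obtain w x y z where "xs = [w, x, y, z]" by (auto simp: eval_nat_numeral length_Suc_conv)
  then show "Poly_Mapping.lookup (delete_letter e (monom xs)) (Word [b, c, d]) =
      Poly_Mapping.lookup (monom xs) (Word [e, b, c, d]) + Poly_Mapping.lookup (monom xs) (Word [b, e, c, d]) +
      Poly_Mapping.lookup (monom xs) (Word [b, c, e, d]) +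
      (Poly_Mapping.lookup (monom xs) (Word [b, c, d, e]) :: 'k)"
    by (simp add: lookup_add lookup_var_mult lookup_monom_Cons)
next
  show "Vector_Spaces.linear pm_scale (*) (\<lambda>p :: ('g, 'k) tens. Poly_Mapping.lookup (delete_letter e p) (Word [b, c, d]))"
    by (rule linearI_pm) (simp_all add: vector_space_times lookup_add delete_letter.add delete_letter.scale)
  show "Vector_Spaces.linear pm_scale (*) (\<lambda>p :: ('g, 'k) tens.
      Poly_Mapping.lookup p (Word [e, b, c, d]) + Poly_Mapping.lookup p (Word [b, e, c, d]) +
      Poly_Mapping.lookup p (Word [b, c, e, d]) + Poly_Mapping.lookup p (Word [b, c, d, e]))"
    by (rule linearI_pm) (simp_all add: vector_space_times lookup_add distrib_left)
qed

text \<open>This is the injectivity, for \<open>g \<ge> 3\<close>, of the product with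
  \<open>\<omega>\<close> from the second to the fourth exterior power, applied to the antisymmetric
  part of \<open>\<Sum>\<^sub>e e \<otimes> h\<^sub>e\<close>. It is verified in
  coordinates.\<close>

lemma omega_coeffs_symmetric:
  fixes p :: "('g::finite, 'k::field_char_0) tens"
  assumes p: "p \<in> tens_deg 4" and h: "\<And>e. h e \<in> HH"
    and del: "\<And>e. delete_letter e p - h e * omega \<in> comm_span"
    and card: "card (UNIV :: 'g set) > 2"
  shows "Poly_Mapping.lookup (h a) (Word [b]) = Poly_Mapping.lookup (h b) (Word [a])"
proof -
  define m where "m a b = Poly_Mapping.lookup (h a) (Word [b])" for a b
  define om where "om a b = Poly_Mapping.lookup (omega :: ('g, 'k) tens) (Word [a, b])" for a b
  have om: "om b a = - om a b" for a b
    by (cases a; cases b) (simp_all add: om_def lookup_omega)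
  \<comment> \<open>Summed over rotations of \<open>bcd\<close>, the coefficient depends only on the
    trace of \<open>delete_letter a p\<close>, so it can be computed from \<open>h a * omega\<close>
    instead.\<close>
  define A where "A a b c d = Poly_Mapping.lookup (delete_letter a p) (Word [b, c, d]) +
    Poly_Mapping.lookup (delete_letter a p) (Word [c, d, b]) +
    Poly_Mapping.lookup (delete_letter a p) (Word [d, b, c])" for a b c d
  have A: "A a b c d = m a b * om c d + m a c * om d b + m a d * om b c" for a b c d
    using cyclic_lookup_comm_span[OF del[of a], of b c d]
    by (simp add: A_def m_def om_def lookup_minus lookup_HH_mult[OF h] algebra_simps)
  \<comment> \<open>the part of \<open>\<Sum>\<^sub>e e \<partial>\<^sub>e p\<close> in the fourth exterior power vanishes, as its four terms cancel in pairs\<close>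
  have alt: "(A a b c d - A a d c b) - (A b a c d - A b d c a) + (A c a b d - A c d b a) - (A d a b c - A d c b a) = 0"
    for a b c d
    unfolding A_def lookup_delete_letter[OF p] by (simp add: algebra_simps)
  \<comment> \<open>As \<open>om\<close> is antisymmetric, \<open>A a d c b = - A a b c d\<close>,
    so \<open>alt\<close> counts everything twice. The bracketed expression is a coefficient of the
    product of \<open>\<omega>\<close> with the antisymmetric part of \<open>m\<close>; in
    characteristic zero the factor 2 can be cancelled.\<close>
  have two: "2 * ((m a b - m b a) * om c d - (m a c - m c a) * om b d + (m a d - m d a) * om b c +
      (m b c - m c b) * om a d - (m b d - m d b) * om a c + (m c d - m d c) * om a b) = 0" for a b c d
    using alt[of a b c d]
    unfolding A om[of d b] om[of d c] om[of c b] om[of d a] om[of c a] om[of b a] by algebra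
  have koszul: "(m a b - m b a) * om c d - (m a c - m c a) * om b d + (m a d - m d a) * om b c +
      (m b c - m c b) * om a d - (m b d - m d b) * om a c + (m c d - m d c) * om a b = 0" for a b c d
    using two[of a b c d] by (metis mult_eq_0_iff zero_neq_numeral)
  have off: "om (X i) (X j) = 0" "om (Y i) (Y j) = 0" "om (X i) (Y j) = (if i = j then 1 else 0)"
    "om (Y i) (X j) = (if i = j then - 1 else 0)" for i j
    by (simp_all add: om_def lookup_omega)
  have ex: "\<exists>k. k \<noteq> i \<and> k \<noteq> j" for i j :: 'g
  proof (rule ccontr)
    assume "\<not> ?thesis"
    then have "UNIV \<subseteq> {i, j}" by auto
    then have "card (UNIV :: 'g set) \<le> card {i, j}" by (rule card_mono[rotated]) simp
    with card show False by (cases "i = j") auto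
  qed
  \<comment> \<open>For distinct indices \<open>i\<close> and \<open>j\<close> the relation gives
    only \<open>n i + n j = 0\<close>. Three distinct indices are needed to conclude
    \<open>2 * n i = 0\<close>.\<close>
  have XY: "m (X i) (Y i) = m (Y i) (X i)" for i
  proof -
    obtain j where j: "j \<noteq> i" using ex by metis
    obtain k where k: "k \<noteq> i" "k \<noteq> j" using ex by metis
    define n where "n i = m (X i) (Y i) - m (Y i) (X i)" for i
    have "n i + n j = 0" "n i + n k = 0" "n j + n k = 0"
      using koszul[of "X i" "Y i" "X j" "Y j"] koszul[of "X i" "Y i" "X k" "Y k"]
        koszul[of "X j" "Y j" "X k" "Y k"] j k
      by (auto simp: off n_def)
    then have "2 * n i = 0" by algebra
    then show ?thesis by (simp add: n_def)
  qed
  define ix :: "'g symp \<Rightarrow> 'g" where "ix a = (case a of X i \<Rightarrow> i | Y i \<Rightarrow> i)" for a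
  \<comment> \<open>With \<open>k\<close> away from the indices of \<open>a\<close> and
    \<open>b\<close>, all mixed values of \<open>om\<close> vanish. The term with
    \<open>om a b\<close> drops out by \<open>XY\<close>, which leaves
    \<open>m a b - m b a\<close>.\<close>
  obtain k where k: "k \<noteq> ix a" "k \<noteq> ix b" using ex by metis
  have "m a b = m b a"
    using koszul[of a b "X k" "Y k"] k XY
    by (cases a; cases b) (auto simp: off ix_def)
  then show ?thesis by (simp add: m_def)
qed

text \<open>For \<open>g = 1\<close> one has \<open>x [x, y] = [x, x y]\<close> and
  \<open>y [x, y] = [y x, y]\<close>.\<close>

lemma HH_mult_omega_in_comm_span:
  fixes h :: "('g::finite, 'k::field) tens"
  assumes "card (UNIV :: 'g set) = 1" "h \<in> HH"
  shows "h * omega \<in> comm_span"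
proof -
  obtain i :: 'g where i: "UNIV = {i}" using assms(1) by (auto simp: card_1_singleton_iff)
  have all: "j = i" for j using i by auto
  have omega: "omega = (var (X i) * var (Y i) - var (Y i) * var (X i) :: ('g, 'k) tens)"
    by (simp add: omega_def bracket_def i)
  have "var a * omega \<in> (comm_span :: ('g, 'k) tens set)" for a
  proof (cases a)
    case (X j)
    then have "var a * omega = bracket (var (X i)) (var (X i) * var (Y i) :: ('g, 'k) tens)"
      by (simp add: omega bracket_def all[of j] algebra_simps)
    then show ?thesis by (simp add: comm_span_bracket)
  next
    case (Y j)
    then have "var a * omega = bracket (var (Y i) * var (X i) :: ('g, 'k) tens) (var (Y i))"
      by (simp add: omega bracket_def all[of j] algebra_simps)
    then show ?thesis by (simp add: comm_span_bracket)
  qed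
  then show ?thesis
    by (subst HH_expand[OF assms(2)])
      (auto simp: sum_distrib_right pm_scale_mult_left
        intro!: pm.subspace_sum[OF subspace_comm_span] pm.subspace_scale[OF subspace_comm_span])
qed

text \<open>Exchanging the two letters of \<open>omega\<close> is reversal up to rotation, so the
  weights 2 and 1 add up to 3. Of the three rotations, one has \<open>b\<close> before
  \<open>omega\<close>, one after it and one between its letters.\<close>

lemma dihedral_var_omega:
  "dihedral (var b * omega) = pm_scale 3 (var b * omega + omega * var b +
    (\<Sum>i\<in>UNIV. monom [Y i, b, X i] - monom [X i, b, Y i]))"
proof -
  have scale: "pm_scale 3 q = q + q + q" for q :: "('a, 'b) tens"
    by (rule poly_mapping_eqI) (simp add: lookup_add)
  have mult_var: "monom xs * var a = (monom (xs @ [a]) :: ('a, 'b) tens)" for xs and a :: "'a symp"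
    by (simp add: var_def mult_single plus_word_def)
  have "dihedral (monom [b, x, y]) - dihedral (monom [b, y, x]) = (pm_scale 3 (monom [b, x, y] - monom [b, y, x]
      + (monom [x, y, b] - monom [y, x, b]) + (monom [y, b, x] - monom [x, b, y])) :: ('a, 'b) tens)" for x y
    unfolding scale by (simp add: dihedral_def rotations_monom lessThan_Suc algebra_simps)
  then show ?thesis
    by (simp add: omega_monom sum_distrib_left sum_distrib_right dihedral.sum dihedral.diff
        right_diff_distrib left_diff_distrib var_mult_monom mult_var pm.scale_sum_right
        del: pm_scale_single flip: sum.distrib)
qed

text \<open>The terms in which \<open>omega\<close> stays intact vanish in
  \<open>|T(H)\<^sub>\<omega>|\<close>. The others are differences of \<open>|a y b x|\<close> and
  \<open>|a x b y|\<close>; rotation by two letters exchanges \<open>a\<close> with \<open>b\<close>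
  and \<open>x\<close> with \<open>y\<close>, hence reverses the sign.\<close>

lemma trace_class_insert_omega_antisym:
  fixes a b :: "'g::finite symp"
  shows "trace_class (var a * dihedral (var b * omega)) =
    - (trace_class (var b * dihedral (var a * omega)) :: ('g, 'k::field) tens_omega trace)"
proof -
  have rot: "trace_class (monom (xs @ ys) :: ('g, 'k) tens) = trace_class (monom (ys @ xs))" for xs ys :: "'g symp list"
    using tr_mult_commute[of "to_omega (monom xs)" "to_omega (monom ys)"]
    by (simp add: mult_single plus_word_def flip: to_omega_mult)
  have ideal: "trace_class (p * omega) = 0" "trace_class (p * omega * q) = 0" for p q :: "('g, 'k) tens"
    using omega_ideal_mult_left[of omega] omega_ideal_mult_right
      lie_ideal_le_omega_ideal[OF lie_ideal.omega]
    by (blast intro: trace_class_omega_ideal)+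
  have W: "trace_class (var a * dihedral (var b * omega)) =
      scale_trace_omega 3 (\<Sum>i\<in>UNIV. trace_class (monom [a, Y i, b, X i]) - trace_class (monom [a, X i, b, Y i] :: ('g, 'k) tens))"
    for a b :: "'g symp"
    by (simp add: dihedral_var_omega distrib_left pm_scale_mult_right trace_class.add trace_class.scale
        trace_class.sum trace_class.diff sum_distrib_left right_diff_distrib var_mult_monom ideal
        del: pm_scale_single flip: mult.assoc)
  have "trace_class (monom [b, y, a, x]) = trace_class (monom [a, x, b, y] :: ('g, 'k) tens)" for x y
    using rot[of "[b, y]" "[a, x]"] by simp
  then show ?thesis
    unfolding W by (simp flip: trace_omega.scale_minus_right sum_negf)
qed

lemma trace_class_insert_delete_4:
  fixes p :: "('g::finite, 'k::field_char_0) tens"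
  assumes p: "p \<in> tens_deg 4" and ker: "trace_red_coprod (trace_class p) = 0"
    and card: "card (UNIV :: 'g set) \<noteq> 2"
  shows "trace_class (\<Sum>e\<in>UNIV. var e * dihedral (delete_letter e p)) = 0"
proof -
  have "\<exists>r\<in>HH. delete_letter e p - r * omega \<in> comm_span" for e
  proof -
    have "delete_letter e p \<in> tens_deg (1 + 2)" using delete_letter_in_tens_deg[of p 3 e] p by (simp add: eval_nat_numeral)
    from tens_deg_mult_omega[OF trace_class_delete_letter[OF ker p] this]
    show ?thesis unfolding tens_deg_1 by simp
  qed
  then obtain h where h: "\<And>e. h e \<in> HH" "\<And>e. delete_letter e p - h e * omega \<in> comm_span" by metis
  consider "card (UNIV :: 'g set) = 1" | "card (UNIV :: 'g set) > 2"
    using card by (metis One_nat_def Suc_lessI finite_UNIV_card_ge_0 finite numeral_2_eq_2)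
  then show ?thesis
  proof cases
    case 1
    have "delete_letter e p \<in> comm_span" for e
      using comm_span_add[OF h(2)[of e] HH_mult_omega_in_comm_span[OF 1 h(1)[of e]]] by simp
    then show ?thesis by (simp add: dihedral_comm_span trace_class.zero)
  next
    case 2
    define m where "m a b = Poly_Mapping.lookup (h a) (Word [b])" for a b
    define W :: "'g symp \<Rightarrow> 'g symp \<Rightarrow> ('g, 'k) tens_omega trace"
      where "W a b = trace_class (var a * dihedral (var b * omega))" for a b
    have dih: "dihedral (delete_letter e p) = (\<Sum>b\<in>UNIV. pm_scale (m e b) (dihedral (var b * omega)))" for e
    proof -
      have "dihedral (delete_letter e p) = dihedral (h e * omega)"
        using dihedral_comm_span[OF h(2)[of e]] by (simp add: dihedral.diff)
      also have "\<dots> = (\<Sum>b\<in>UNIV. pm_scale (m e b) (dihedral (var b * omega)))"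
        by (subst HH_expand[OF h(1)])
          (simp add: m_def sum_distrib_right pm_scale_mult_left dihedral.sum dihedral.scale)
      finally show ?thesis .
    qed
    \<comment> \<open>A symmetric matrix \<open>m\<close> is paired with an antisymmetric
      \<open>W\<close>, so the total below equals its own negative.\<close>
    have "m a b = m b a" "W a b = - W b a" for a b
      using omega_coeffs_symmetric[OF p h 2] trace_class_insert_omega_antisym
      by (simp_all add: m_def W_def)
    then have antisym: "scale_trace_omega (m a b) (W a b) = - scale_trace_omega (m b a) (W b a)" for a b
      by (metis trace_omega.scale_minus_right)
    let ?T = "trace_class (\<Sum>e\<in>UNIV. var e * dihedral (delete_letter e p))"
    have T: "?T = (\<Sum>a\<in>UNIV. \<Sum>b\<in>UNIV. scale_trace_omega (m a b) (W a b))"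
      by (simp add: dih sum_distrib_left pm_scale_mult_right trace_class.sum trace_class.scale W_def)
    also have "\<dots> = (\<Sum>a\<in>UNIV. \<Sum>b\<in>UNIV. - scale_trace_omega (m b a) (W b a))"
      by (intro sum.cong refl antisym)
    also have "\<dots> = - ?T"
      unfolding T by (subst sum.swap) (simp add: sum_negf)
    finally have "?T + ?T = 0" by (simp only: eq_neg_iff_add_eq_0)
    then have "scale_trace_omega 2 ?T = 0"
      using trace_omega.scale_left_distrib[of 1 1 ?T] by simp
    then show ?thesis by simp
  qed
qed

section \<open>The kernels\<close>

text \<open>An element of \<open>H\<close> is determined by its letter coefficients, and these are
  functions of its trace class.\<close>

lemma trace_class_inj_on_HH: "inj_on trace_class (HH :: ('g::finite, 'k::field) tens set)"
proof (rule inj_onI)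
  fix u v :: "('g, 'k) tens"
  assume *: "u \<in> HH" "v \<in> HH" "trace_class u = trace_class v"
  then have "Poly_Mapping.lookup u (Word [b]) = Poly_Mapping.lookup v (Word [b])" for b
    by (metis letter_coeff_trace_class)
  with HH_expand[OF *(1)] HH_expand[OF *(2)] show "u = v" by simp
qed

lemma Ker_deg_1: "Ker_deg 1 = trace_class ` HH"
  unfolding Ker_deg_def trace_omega_deg_def tens_deg_1 by (auto simp: trace_red_coprod_HH)

lemma Ker_deg_2: "(Ker_deg 2 :: ('g::finite, 'k::field_char_0) tens_omega trace set) = {0}"
proof -
  have "trace_class p = 0"
    if p: "p \<in> tens_deg 2" and ker: "trace_red_coprod (trace_class p) = 0" for p :: "('g, 'k) tens"
  proof -
    \<comment> \<open>The deletion lies in \<open>H\<close>, where the projection to the trace space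
      is injective, so it vanishes in \<open>T(H)\<close> itself.\<close>
    have "delete_letter e p = 0" for e
    proof (rule inj_onD[OF trace_class_inj_on_HH])
      show "delete_letter e p \<in> HH"
        using delete_letter_in_tens_deg[of p 1 e] p by (simp add: numeral_2_eq_2 flip: tens_deg_1)
    qed (simp_all add: trace_class_delete_letter[OF ker p] trace_class.zero HH_def pm.span_zero)
    then have "trace_class (p + p) = 0"
      using trace_class_comm_span[OF sum_insert_delete_2[OF p]] by simp
    then have "scale_trace_omega 2 (trace_class p) = 0"
      using trace_omega.scale_left_distrib[of 1 1 "trace_class p"] by (simp add: trace_class.add)
    then show ?thesis by simp
  qed
  moreover have "(0 :: ('g, 'k) tens) \<in> tens_deg 2" by (rule pm.subspace_0[OF subspace_tens_deg])
  moreover have "trace_red_coprod (trace_class (0 :: ('g, 'k) tens)) = 0"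
    by (rule trace_red_coprod_HH) (simp add: HH_def pm.span_zero)
  ultimately show ?thesis
    by (force simp: Ker_deg_def trace_omega_deg_def trace_class.zero)
qed

lemma bracket_in_tens_deg: "p \<in> tens_deg m \<Longrightarrow> q \<in> tens_deg n \<Longrightarrow> bracket p q \<in> tens_deg (m + n)"
  unfolding bracket_def
  using mult_in_tens_deg[of p m q n] mult_in_tens_deg[of q n p m]
  by (simp add: add.commute pm.subspace_diff[OF subspace_tens_deg])

lemma var_in_HH: "var a \<in> HH"
  by (simp add: HH_def pm.span_base)

lemma var_in_tens_deg: "var a \<in> tens_deg 1"
  using var_in_HH HH_le_tens_deg by blast

lemma twist_in_span_HH_lie:
  assumes "p \<in> tens_deg 3" shows "twist p \<in> pm.span (HH_lie 2)"
proof (rule linear_mem_of_monom[OF twist.linear_axioms pm.subspace_span _ assms])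
  fix xs :: "'a symp list" assume "length xs = 3"
  then obtain a b c where xs: "xs = [a, b, c]" by (auto simp: numeral_3_eq_3 length_Suc_conv)
  have "twist (monom xs :: ('a, 'b) tens) = var a * bracket (var b) (var c)"
    by (simp add: xs twist_monom bracket_monom right_diff_distrib var_mult_monom)
  moreover have "bracket (var b) (var c) \<in> (free_lie \<inter> tens_deg 2 :: ('a, 'b) tens set)"
    using bracket_in_tens_deg[OF var_in_tens_deg var_in_tens_deg]
    by (auto intro: free_lie.intros var_in_HH simp: numeral_2_eq_2)
  ultimately show "twist (monom xs) \<in> (pm.span (HH_lie 2) :: ('a, 'b) tens set)"
    using var_in_HH by (force intro: pm.span_base)
qed

lemma nested_twist_in_span_HH_lie:
  assumes "p \<in> tens_deg 4" shows "nested_twist p \<in> pm.span (HH_lie 3)"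
proof (rule linear_mem_of_monom[OF nested_twist.linear_axioms pm.subspace_span _ assms])
  fix xs :: "'a symp list" assume "length xs = 4"
  then obtain a b c d where xs: "xs = [a, b, c, d]" by (auto simp: eval_nat_numeral length_Suc_conv)
  have mem: "var a * bracket (var x) (bracket (var y) (var z)) \<in> (pm.span (HH_lie 3) :: ('a, 'b) tens set)"
    for x y z
  proof -
    have "bracket (var x) (bracket (var y) (var z)) \<in> (free_lie \<inter> tens_deg 3 :: ('a, 'b) tens set)"
      using bracket_in_tens_deg[OF var_in_tens_deg bracket_in_tens_deg[OF var_in_tens_deg var_in_tens_deg]]
      by (auto intro: free_lie.intros var_in_HH simp: numeral_3_eq_3)
    then show ?thesis using var_in_HH by (force intro: pm.span_base)
  qed
  show "nested_twist (monom xs) \<in> (pm.span (HH_lie 3) :: ('a, 'b) tens set)"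
    unfolding xs nested_twist_monom right_diff_distrib by (intro pm.span_diff mem)
qed

text \<open>Each deletion is, up to commutators, a scalar multiple of \<open>omega\<close>, and
  \<open>omega\<close> is itself a sum of commutators. So the reinsertion sum vanishes and
  \<open>6|p| = 3|twist p|\<close>.\<close>

lemma trace_class_twist:
  fixes p :: "('g::finite, 'k::field_char_0) tens"
  assumes p: "p \<in> tens_deg 3" and ker: "trace_red_coprod (trace_class p) = 0"
  shows "trace_class p = scale_trace_omega (1 / 2) (trace_class (twist p))"
proof -
  have "rotations (delete_letter e p) = 0" for e
  proof -
    have "delete_letter e p \<in> tens_deg (0 + 2)"
      using delete_letter_in_tens_deg[of p 2 e] p by (simp add: eval_nat_numeral)
    from tens_deg_mult_omega[OF trace_class_delete_letter[OF ker p] this]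
    obtain r where r: "r \<in> tens_deg 0" "delete_letter e p - r * omega \<in> comm_span" by auto
    have "r * omega \<in> comm_span"
    proof (rule linear_mem_of_monom[OF _ subspace_comm_span _ r(1)])
      show "Vector_Spaces.linear pm_scale pm_scale (\<lambda>r :: ('g, 'k) tens. r * omega)"
        by (rule linearI_pm) (simp_all add: pm.vector_space_axioms distrib_right pm_scale_mult_left)
    qed (simp add: omega_in_comm_span flip: zero_word_def)
    from rotations_comm_span[OF comm_span_add[OF r(2) this]] show ?thesis by simp
  qed
  then have "pm_scale 6 p - pm_scale 3 (twist p) \<in> comm_span"
    using sum_insert_delete_3[OF p] by simp
  from trace_class_comm_span[OF this]
  have "scale_trace_omega 6 (trace_class p) = scale_trace_omega 3 (trace_class (twist p))"
    by (simp add: trace_class.diff trace_class.scale)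
  then have "scale_trace_omega (1 / 6) (scale_trace_omega 6 (trace_class p)) =
      scale_trace_omega (1 / 6) (scale_trace_omega 3 (trace_class (twist p)))" by simp
  then show ?thesis by simp
qed

lemma Ker_deg_3:
  "(Ker_deg 3 :: ('g::finite, 'k::field_char_0) tens_omega trace set) = trace_class ` pm.span (HH_lie 2)"
proof
  show "Ker_deg 3 \<subseteq> (trace_class ` pm.span (HH_lie 2) :: ('g, 'k) tens_omega trace set)"
  proof
    fix t :: "('g, 'k) tens_omega trace" assume "t \<in> Ker_deg 3"
    then obtain p where p: "t = trace_class p" "p \<in> tens_deg 3" "trace_red_coprod (trace_class p) = 0"
      by (auto simp: Ker_deg_def trace_omega_deg_def)
    have "t = trace_class (pm_scale (1 / 2) (twist p))"
      by (simp add: p(1) trace_class_twist[OF p(2,3)] trace_class.scale)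
    then show "t \<in> trace_class ` pm.span (HH_lie 2)"
      using pm.span_scale[OF twist_in_span_HH_lie[OF p(2)]] by blast
  qed
  show "trace_class ` pm.span (HH_lie 2) \<subseteq> (Ker_deg 3 :: ('g, 'k) tens_omega trace set)"
    using HH_lie_subset_Ker[of 2] by (simp add: numeral_3_eq_3 numeral_2_eq_2)
qed

text \<open>For \<open>g \<noteq> 2\<close> the reinsertion sum vanishes in
  \<open>|T(H)\<^sub>\<omega>|\<close>, so a kernel element \<open>|p|\<close> is one sixth of the
  trace of \<open>nested_twist p\<close>, which is a combination of elements of
  \<open>H L(H)\<close>.\<close>

lemma Ker_deg_4:
  assumes card: "card (UNIV :: 'g::finite set) \<noteq> 2"
  shows "(Ker_deg 4 :: ('g, 'k::field_char_0) tens_omega trace set) = trace_class ` pm.span (HH_lie 3)"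
proof
  show "Ker_deg 4 \<subseteq> (trace_class ` pm.span (HH_lie 3) :: ('g, 'k) tens_omega trace set)"
  proof
    fix t :: "('g, 'k) tens_omega trace" assume "t \<in> Ker_deg 4"
    then obtain p where p: "t = trace_class p" "p \<in> tens_deg 4" "trace_red_coprod (trace_class p) = 0"
      by (auto simp: Ker_deg_def trace_omega_deg_def)
    have "scale_trace_omega 12 (trace_class p) = scale_trace_omega 2 (trace_class (nested_twist p))"
      using trace_class_comm_span[OF sum_insert_delete_4[OF p(2)]]
        trace_class_insert_delete_4[OF p(2,3) card]
      by (simp only: trace_class.diff trace_class.scale) simp
    then have "scale_trace_omega (1 / 12) (scale_trace_omega 12 (trace_class p)) =
        scale_trace_omega (1 / 12) (scale_trace_omega 2 (trace_class (nested_twist p)))" by simp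
    then have "t = trace_class (pm_scale (1 / 6) (nested_twist p))"
      by (simp add: p(1) trace_class.scale)
    then show "t \<in> trace_class ` pm.span (HH_lie 3)"
      using pm.span_scale[OF nested_twist_in_span_HH_lie[OF p(2)]] by blast
  qed
  show "trace_class ` pm.span (HH_lie 3) \<subseteq> (Ker_deg 4 :: ('g, 'k) tens_omega trace set)"
    using HH_lie_subset_Ker[of 3] by (simp add: eval_nat_numeral)
qed

section \<open>The isomorphism from the third exterior power modulo
  \<open>|H \<omega>|\<close>\<close>

definition project_trace :: "('g::finite, 'k::field) tens trace \<Rightarrow> ('g, 'k) tens_omega trace" where
  "project_trace t = trace_class (rep_trace t)"

lemma project_trace_tr: "project_trace (tr p) = trace_class p"
proof -
  have "rep_trace (tr p) - p \<in> comm_span"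
    using Quotient3_abs_rep[OF Quotient3_trace, of "tr p"] by (simp only: tr_eq_iff)
  from trace_class_comm_span[OF this] show ?thesis
    by (simp add: project_trace_def trace_class.diff)
qed

lemma wedge_to_trace_cases:
  obtains p where "p \<in> tens_deg 3" "\<eta> = abs_wedge3 p" "wedge_to_trace \<eta> = tr (twist p)"
proof -
  have "\<exists>p \<in> tens_deg 3. \<eta> = abs_wedge3 p"
    by (induction \<eta> rule: wedge3.abs_induct) auto
  with that wedge_to_trace_abs show ?thesis by blast
qed

text \<open>In degree three, \<open>tens_deg_mult_omega\<close> says that the kernel of
  \<open>|T(H)| \<rightarrow> |T(H)\<^sub>\<omega>|\<close> is \<open>|H \<omega>|\<close>. This
  gives both the well-definedness and the injectivity of the map on the quotient.\<close>

lemma project_wedge_to_trace_eq_0_iff: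
  fixes \<eta> :: "('g::finite, 'k::field) wedge3"
  shows "project_trace (wedge_to_trace \<eta>) = 0 \<longleftrightarrow> \<eta> \<in> H_omega"
proof -
  obtain p where p: "p \<in> tens_deg 3" "wedge_to_trace \<eta> = tr (twist p)" by (rule wedge_to_trace_cases)
  let ?S = "{h * w | h w. h \<in> HH \<and> w \<in> range (\<lambda>c. pm_scale c omega)} :: ('g, 'k) tens set"
  have H_omega: "\<eta> \<in> H_omega \<longleftrightarrow> tr (twist p) \<in> tr ` pm.span ?S"
    by (simp add: H_omega_def p(2) trace_prod_def)
  show ?thesis
  proof
    assume "project_trace (wedge_to_trace \<eta>) = 0"
    then have "trace_class (twist p) = 0" by (simp add: p(2) project_trace_tr)
    moreover have "twist p \<in> tens_deg (1 + 2)"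
      using twist_in_span_HH_lie[OF p(1)] pm.span_minimal[OF HH_lie_subset_tens_deg subspace_tens_deg]
      by (auto simp: eval_nat_numeral)
    ultimately obtain r where r: "r \<in> HH" "twist p - r * omega \<in> comm_span"
      using tens_deg_mult_omega[of "twist p" 1] unfolding tens_deg_1 by auto
    have "omega \<in> range (\<lambda>c. pm_scale c (omega :: ('g, 'k) tens))" by (rule range_eqI[of _ _ 1]) simp
    with r(1) have "r * omega \<in> ?S" by blast
    then have "tr (r * omega) \<in> tr ` pm.span ?S" by (intro imageI pm.span_base)
    moreover have "tr (twist p) = tr (r * omega)" using r(2) by (simp only: tr_eq_iff)
    ultimately show "\<eta> \<in> H_omega" unfolding H_omega by (simp only:)
  next
    assume "\<eta> \<in> H_omega"
    then obtain z where z: "z \<in> pm.span ?S" "tr (twist p) = tr z" unfolding H_omega by auto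
    have "?S \<subseteq> omega_ideal"
      using lie_ideal_le_omega_ideal[OF lie_ideal.scale[OF lie_ideal.omega]]
      by (auto intro: omega_ideal_mult_left)
    then have "pm.span ?S \<subseteq> omega_ideal"
      by (rule pm.span_minimal) (simp add: omega_ideal_def)
    with z show "project_trace (wedge_to_trace \<eta>) = 0"
      by (auto simp: p(2) project_trace_tr trace_class_omega_ideal)
  qed
qed

definition wedge3_mod_to_trace :: "('g::finite, 'k::field) wedge3_mod_omega \<Rightarrow> ('g, 'k) tens_omega trace" where
  "wedge3_mod_to_trace x = project_trace (wedge_to_trace (rep_wedge3_mod x))"

lemma linear_project_wedge_to_trace:
  "Vector_Spaces.linear scale_wedge3 scale_trace_omega (\<lambda>\<eta>. project_trace (wedge_to_trace \<eta>))"
proof -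
  interpret L: Vector_Spaces.linear scale_wedge3 scale_trace wedge_to_trace by (rule linear_wedge_to_trace)
  have ex: "\<exists>p. t = tr p" for t :: "('b, 'a) tens trace"
    by (metis Quotient3_abs_rep[OF Quotient3_trace])
  have add: "project_trace (s + t) = project_trace s + project_trace t" for s t :: "('b, 'a) tens trace"
    using ex[of s] ex[of t] by (auto simp: project_trace_tr trace_class.add simp flip: tr.add)
  have scale: "project_trace (scale_trace c t) = scale_trace_omega c (project_trace t)"
    for c and t :: "('b, 'a) tens trace"
    using ex[of t] by (auto simp: project_trace_tr trace_class.scale simp flip: tr.scale)
  show ?thesis
    unfolding linear_iff_module_hom module_hom_iff
    by (simp add: module_iff_vector_space wedge3.vector_space_axioms trace_omega.vector_space_axioms
        L.add L.scale add scale)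
qed

lemma wedge3_mod_to_trace: "wedge3_mod_to_trace (to_wedge3_mod \<eta>) = project_trace (wedge_to_trace \<eta>)"
proof -
  interpret L: Vector_Spaces.linear scale_wedge3 scale_trace_omega "\<lambda>\<eta>. project_trace (wedge_to_trace \<eta>)"
    by (rule linear_project_wedge_to_trace)
  have "rep_wedge3_mod (to_wedge3_mod \<eta>) - \<eta> \<in> H_omega"
    using Quotient3_abs_rep[OF Quotient3_wedge3_mod_omega, of "to_wedge3_mod \<eta>"]
    by (simp only: wedge3_mod_omega.abs_eq_iff)
  then show ?thesis
    by (simp add: wedge3_mod_to_trace_def L.diff flip: project_wedge_to_trace_eq_0_iff)
qed

lemma linear_wedge3_mod_to_trace:
  "Vector_Spaces.linear scale_wedge3_mod scale_trace_omega wedge3_mod_to_trace"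
proof -
  interpret L: Vector_Spaces.linear scale_wedge3 scale_trace_omega "\<lambda>\<eta>. project_trace (wedge_to_trace \<eta>)"
    by (rule linear_project_wedge_to_trace)
  have "wedge3_mod_to_trace (x + y) = wedge3_mod_to_trace x + wedge3_mod_to_trace y"
    for x y :: "('b, 'a) wedge3_mod_omega"
    by (induction x rule: wedge3_mod_omega.abs_induct, induction y rule: wedge3_mod_omega.abs_induct)
      (simp add: plus_wedge3_mod_omega.abs_eq wedge3_mod_to_trace L.add)
  moreover have "wedge3_mod_to_trace (scale_wedge3_mod c x) = scale_trace_omega c (wedge3_mod_to_trace x)"
    for c and x :: "('b, 'a) wedge3_mod_omega"
    by (induction x rule: wedge3_mod_omega.abs_induct)
      (simp add: scale_wedge3_mod.abs_eq wedge3_mod_to_trace L.scale)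
  ultimately show ?thesis
    unfolding linear_iff_module_hom module_hom_iff
    by (simp add: module_iff_vector_space wedge3_mod.vector_space_axioms trace_omega.vector_space_axioms)
qed

lemma bij_betw_wedge3_mod_to_trace:
  "bij_betw wedge3_mod_to_trace UNIV
    (trace_class ` pm.span (HH_lie 2) :: ('g::finite, 'k::field_char_0) tens_omega trace set)"
proof -
  interpret f: Vector_Spaces.linear scale_wedge3_mod scale_trace_omega
    "wedge3_mod_to_trace :: ('g, 'k) wedge3_mod_omega \<Rightarrow> _"
    by (rule linear_wedge3_mod_to_trace)
  have "x = 0" if "wedge3_mod_to_trace x = 0" for x :: "('g, 'k) wedge3_mod_omega"
    using that
    by (induction x rule: wedge3_mod_omega.abs_induct)
      (simp add: wedge3_mod_to_trace project_wedge_to_trace_eq_0_iff zero_wedge3_mod_omega.abs_eq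
        wedge3_mod_omega.abs_eq_iff)
  then have "inj (wedge3_mod_to_trace :: ('g, 'k) wedge3_mod_omega \<Rightarrow> _)"
    by (simp add: f.inj_iff_eq_0)
  moreover have "range wedge3_mod_to_trace = (trace_class ` pm.span (HH_lie 2) :: ('g, 'k) tens_omega trace set)"
  proof
    show "range wedge3_mod_to_trace \<subseteq> (trace_class ` pm.span (HH_lie 2) :: ('g, 'k) tens_omega trace set)"
    proof (rule image_subsetI)
      fix x :: "('g, 'k) wedge3_mod_omega"
      obtain p where "p \<in> tens_deg 3" "wedge_to_trace (rep_wedge3_mod x) = tr (twist p)"
        by (rule wedge_to_trace_cases)
      then show "wedge3_mod_to_trace x \<in> trace_class ` pm.span (HH_lie 2)"
        unfolding wedge3_mod_to_trace_def
        by (simp only: project_trace_tr) (intro imageI twist_in_span_HH_lie)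
    qed
    show "(trace_class ` pm.span (HH_lie 2) :: ('g, 'k) tens_omega trace set) \<subseteq> range wedge3_mod_to_trace"
    proof
      fix t :: "('g, 'k) tens_omega trace" assume "t \<in> trace_class ` pm.span (HH_lie 2)"
      \<comment> \<open>Surjectivity goes through the kernel: there \<open>trace_class_twist\<close>
        exhibits \<open>t\<close> as half the image of the class of \<open>p\<close> in the exterior
        power.\<close>
      then have "t \<in> Ker_deg 3" unfolding Ker_deg_3 .
      then obtain p where p: "t = trace_class p" "p \<in> tens_deg 3" "trace_red_coprod (trace_class p) = 0"
        by (auto simp: Ker_deg_def trace_omega_deg_def)
      have "t = scale_trace_omega (1 / 2) (wedge3_mod_to_trace (to_wedge3_mod (abs_wedge3 p)))"
        by (simp add: wedge3_mod_to_trace wedge_to_trace_abs[OF p(2)] project_trace_tr p(1)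
            trace_class_twist[OF p(2,3)])
      then show "t \<in> range wedge3_mod_to_trace" by (metis f.scale rangeI)
    qed
  qed
  ultimately show ?thesis by (simp add: bij_betw_def)
qed

theorem proposition7p1:
  shows "bij_betw (\<lambda>v. tr (to_omega v)) HH
      (Ker_deg 1 :: ('g::finite, 'k::field_char_0) tens_omega trace set) \<and>
    (Ker_deg 2 :: ('g, 'k) tens_omega trace set) = {0} \<and>
    (Ker_deg 3 :: ('g, 'k) tens_omega trace set) =
      trace_prod scale_omega (to_omega ` HH) (lie_to_tens_omega ` lie_omega_deg 2) \<and>
    (\<exists>f :: ('g, 'k) wedge3_mod_omega \<Rightarrow> ('g, 'k) tens_omega trace.
      Vector_Spaces.linear scale_wedge3_mod scale_trace_omega f \<and>
      bij_betw f UNIV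
        (trace_prod scale_omega (to_omega ` HH) (lie_to_tens_omega ` lie_omega_deg 2)) \<and>
      (\<forall>u\<in>HH. \<forall>v\<in>HH. \<forall>w\<in>HH.
        f (to_wedge3_mod (wedge u v w)) = tr (to_omega (u * bracket v w)))) \<and>
    (card (UNIV :: 'g set) \<noteq> 2 \<longrightarrow>
      (Ker_deg 4 :: ('g, 'k) tens_omega trace set) =
        trace_prod scale_omega (to_omega ` HH) (lie_to_tens_omega ` lie_omega_deg 3))"
proof (intro conjI impI exI)
  show "bij_betw (\<lambda>v. tr (to_omega v)) HH (Ker_deg 1 :: ('g, 'k) tens_omega trace set)"
    unfolding bij_betw_def Ker_deg_1 by (simp add: trace_class_inj_on_HH)
  show "(Ker_deg 2 :: ('g, 'k) tens_omega trace set) = {0}"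
    by (rule Ker_deg_2)
  show "(Ker_deg 3 :: ('g, 'k) tens_omega trace set) =
      trace_prod scale_omega (to_omega ` HH) (lie_to_tens_omega ` lie_omega_deg 2)"
    unfolding trace_prod_lie by (rule Ker_deg_3)
  show "Vector_Spaces.linear scale_wedge3_mod scale_trace_omega
      (wedge3_mod_to_trace :: ('g, 'k) wedge3_mod_omega \<Rightarrow> _)"
    by (rule linear_wedge3_mod_to_trace)
  show "bij_betw (wedge3_mod_to_trace :: ('g, 'k) wedge3_mod_omega \<Rightarrow> _) UNIV
      (trace_prod scale_omega (to_omega ` HH) (lie_to_tens_omega ` lie_omega_deg 2))"
    unfolding trace_prod_lie by (rule bij_betw_wedge3_mod_to_trace)
  show "\<forall>u\<in>HH. \<forall>v\<in>HH. \<forall>w\<in>HH.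
      wedge3_mod_to_trace (to_wedge3_mod (wedge u v w)) = tr (to_omega (u * bracket v w :: ('g, 'k) tens))"
    by (simp add: wedge3_mod_to_trace wedge_to_trace project_trace_tr)
  show "(Ker_deg 4 :: ('g, 'k) tens_omega trace set) =
      trace_prod scale_omega (to_omega ` HH) (lie_to_tens_omega ` lie_omega_deg 3)"
    if "card (UNIV :: 'g set) \<noteq> 2"
    unfolding trace_prod_lie using that by (rule Ker_deg_4)
qed

end
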